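(* For $j\in\mathbb N$ let $\mathrm{Dir}_j$ be the Dirichlet distribution on the $2^j$-dimensional unit simplex (probability vectors with $2^j$ coordinates) with all parameters equal to one, and let $\Pi_j$ be the law, on the space of probability densities on $[0,1]$, of the random histogram $$\sum_{k=1}^{2^j}a_{jk}\,2^j\,1_{\left(\frac{k-1}{2^j},\frac k{2^j}\right]}(x),\qquad x\in[0,1],\qquad\{a_{jk}\}_{k=1}^{2^j}\sim\mathrm{Dir}_j.$$ Let $X_1,\dots,X_n$ be i.i.d. on $[0,1]$ with law $P_0$ and density $p_0\in\mathcal C^\alpha([0,1])$, $0<\alpha\le1$, satisfying $p_0>0$ on $[0,1]$. Let $j_n$ be such that $2^{j_n}\sim(n/\log n)^{1/(2\alpha+1)}$, let $1\le r\le\infty$, $\bar r=\max(2,r)$, and let either $\alpha>1/2$ or $r=1$. Then for some finite positive $M$ and $\eta=\eta(\alpha,r)$, as $n\to\infty$, $$\Pi_{j_n}\Big\{p\in\mathcal P:\|p-p_0\|_r\ge Mn^{-\frac{\alpha-1/2+1/\bar r}{2\alpha+1}}(\log n)^\eta\,\Big|\,X_1,\dots,X_n\Big\}\to0$$ in $P_0^{\mathbb N}$-probability.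
   Context: $\mathcal P$ is the class of probability densities on $[0,1]$; $\|\cdot\|_r$ is the $L^r([0,1])$-norm, $\|\cdot\|_\infty$ the supremum norm, and $1/\bar r=0$ if $r=\infty$. The posterior is $\Pi(A|X_1,\dots,X_n)=\int_A\prod_{i=1}^np(X_i)\,d\Pi(p)\big/\int\prod_{i=1}^np(X_i)\,d\Pi(p)$. The notation $2^{j_n}\sim a_n$ means that the ratio $2^{j_n}/a_n$ is bounded above and below by fixed positive constants. $\mathcal C^\alpha([0,1])$ is the Hölder space of order $\alpha$ (the Hölder–Zygmund space $B^1_{\infty\infty}([0,1])$ if $\alpha=1$).
   Formalization: For r=∞ the norm is the essential supremum (equal here to the supremum over (0,1]) rather than the supremum over [0,1]: every histogram vanishes at x=0 while p_0(0)>0, so with the literal supremum norm the claim is false. *)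

theory Defs
  imports "HOL-Probability.Probability" "HOL-Library.Landau_Symbols"
begin

abbreviation unit_interval :: "real measure" where
  "unit_interval \<equiv> restrict_space lborel {0..1}"

text \<open>Functions on \<open>[0,1]\<close> are represented by functions on the reals; all notions below depend
  only on their values on \<open>[0,1]\<close>.\<close>

definition densities :: "(real \<Rightarrow> real) set" where
  "densities = {p \<in> borel_measurable unit_interval.
     (\<forall>x\<in>{0..1}. 0 \<le> p x) \<and> (\<integral>\<^sup>+x. ennreal (p x) \<partial>unit_interval) = 1}"

text \<open>For \<open>r = \<infinity>\<close> the supremum is the essential one, as appropriate for densities, which are defined
  up to null sets. The pointwise supremum over the closed interval is not suitable: the
  histograms below vanish at the point \<open>0\<close>, where the true density is positive. See
  \<open>Lr_norm_infinity_histogram\<close> below for the comparison with the pointwise supremum.\<close>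

definition Lr_norm :: "ereal \<Rightarrow> (real \<Rightarrow> real) \<Rightarrow> ereal" where
  "Lr_norm r f =
     (if r = \<infinity> then esssup unit_interval (\<lambda>x. ereal \<bar>f x\<bar>)
      else let s = real_of_ereal r; I = (\<integral>\<^sup>+x. ennreal (\<bar>f x\<bar> powr s) \<partial>unit_interval)
           in if I = \<infinity> then \<infinity> else ereal (enn2real I powr (1 / s)))"

text \<open>\<open>C\<^sup>\<alpha>([0,1])\<close> for \<open>0 < \<alpha> \<le> 1\<close>. At \<open>\<alpha> = 1\<close> this is the Zygmund class \<open>B\<^sup>1\<^sub>\<infinity>\<^sub>\<infinity>([0,1])\<close>, described by second
  differences, which is strictly larger than the class of Lipschitz functions.\<close>

definition holder_class :: "real \<Rightarrow> (real \<Rightarrow> real) set" where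
  "holder_class \<alpha> =
     (if \<alpha> = 1
      then {f. continuous_on {0..1} f \<and>
               (\<exists>L. \<forall>x h. x - h \<in> {0..1} \<and> x + h \<in> {0..1} \<longrightarrow>
                      \<bar>f (x + h) - 2 * f x + f (x - h)\<bar> \<le> L * \<bar>h\<bar>)}
      else {f. \<exists>L. \<forall>x\<in>{0..1}. \<forall>y\<in>{0..1}. \<bar>f x - f y\<bar> \<le> L * \<bar>x - y\<bar> powr \<alpha>})"

definition prob_vectors :: "nat \<Rightarrow> (nat \<Rightarrow> real) set" where
  "prob_vectors N = {a \<in> extensional {1..N}. (\<forall>k\<in>{1..N}. 0 \<le> a k) \<and> (\<Sum>k=1..N. a k) = 1}"

text \<open>The Dirichlet distribution is given by its usual Lebesgue density in the first \<open>N - 1\<close> coordinates,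
  the last coordinate being determined by the others. The density is taken to be zero on the
  relative boundary of the simplex, a null set, where \<open>powr\<close> has the wrong value
  (\<open>0 powr 0 = 0\<close>).\<close>

definition complete_vector :: "nat \<Rightarrow> (nat \<Rightarrow> real) \<Rightarrow> nat \<Rightarrow> real" where
  "complete_vector N x = (\<lambda>k\<in>{1..N}. if k < N then x k else 1 - (\<Sum>i=1..<N. x i))"

definition dirichlet_density :: "nat \<Rightarrow> (nat \<Rightarrow> real) \<Rightarrow> (nat \<Rightarrow> real) \<Rightarrow> real" where
  "dirichlet_density N \<theta> a =
     (if \<forall>k\<in>{1..N}. 0 < a k
      then Gamma (\<Sum>k=1..N. \<theta> k) / (\<Prod>k=1..N. Gamma (\<theta> k)) * (\<Prod>k=1..N. a k powr (\<theta> k - 1))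
      else 0)"

definition dirichlet :: "nat \<Rightarrow> (nat \<Rightarrow> real) \<Rightarrow> (nat \<Rightarrow> real) measure" where
  "dirichlet N \<theta> =
     restrict_space
       (distr (density (PiM {1..<N} (\<lambda>_. lborel))
                 (\<lambda>x. ennreal (dirichlet_density N \<theta> (complete_vector N x))))
              (PiM {1..N} (\<lambda>_. borel))
              (complete_vector N))
       (prob_vectors N)"

definition histogram :: "nat \<Rightarrow> (nat \<Rightarrow> real) \<Rightarrow> real \<Rightarrow> real" where
  "histogram j a x =
     (\<Sum>k=1..2^j. a k * 2^j * indicator {(real k - 1) / 2^j <.. real k / 2^j} x)"

lemma histogram_eq:
  assumes "k \<in> {1..2^j}" "x \<in> {(real k - 1) / 2^j <.. real k / 2^j}"
  shows "histogram j a x = a k * 2^j"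
proof -
  have "indicator {(real i - 1) / 2^j <.. real i / 2^j} x = (if i = k then 1 else 0 :: real)"
    if "i \<in> {1..2^j}" for i
  proof -
    have "i = k" if "real i - 1 < x * 2^j" "x * 2^j \<le> real i" "real k - 1 < x * 2^j" "x * 2^j \<le> real k"
      using that by linarith
    then show ?thesis
      using assms(2) by (auto simp: indicator_def field_simps)
  qed
  then have "histogram j a x = (\<Sum>i=1..2^j. if i = k then a k * 2^j else 0)"
    unfolding histogram_def by (intro sum.cong) auto
  also have "\<dots> = a k * 2^j"
    using assms(1) by simp
  finally show ?thesis .
qed

lemma histogram_cell:
  assumes "x \<in> {0<..1}"
  obtains k where "k \<in> {1..2^j}" "x \<in> {(real k - 1) / 2^j <.. real k / 2^j}"
proof -
  define k where "k = nat \<lceil>x * 2^j\<rceil>"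
  have pos: "0 < x * 2^j" and le: "x * 2^j \<le> 2^j"
    using assms by auto
  have "\<lceil>x * 2^j\<rceil> \<le> 2^j"
    using le by (simp add: ceiling_le_iff)
  moreover have "0 < \<lceil>x * 2^j\<rceil>"
    using pos by simp
  ultimately have "k \<in> {1..2^j}"
    unfolding k_def by (simp add: nat_le_iff le_nat_iff)
  moreover have "real k = of_int \<lceil>x * 2^j\<rceil>"
    unfolding k_def using \<open>0 < \<lceil>x * 2^j\<rceil>\<close> by simp
  then have "real k - 1 < x * 2^j" "x * 2^j \<le> real k"
    by linarith+
  then have "x \<in> {(real k - 1) / 2^j <.. real k / 2^j}"
    by (auto simp: field_simps)
  ultimately show ?thesis
    using that by blast
qed

lemma borel_measurable_histogram [measurable]: "histogram j a \<in> borel_measurable unit_interval"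
  unfolding histogram_def by (intro measurable_restrict_space1) measurable

lemma histogram_in_densities:
  assumes "a \<in> prob_vectors (2^j)"
  shows "histogram j a \<in> densities"
proof -
  have nn: "0 \<le> a k" if "k \<in> {1..2^j}" for k
    using assms that by (auto simp: prob_vectors_def)
  have "(\<integral>\<^sup>+x. ennreal (histogram j a x) \<partial>unit_interval)
      = (\<integral>\<^sup>+x. ennreal (histogram j a x) * indicator {0..1} x \<partial>lborel)"
    by (subst nn_integral_restrict_space) auto
  also have "\<dots> = (\<integral>\<^sup>+x. (\<Sum>k=1..2^j. ennreal (a k * 2^j) * indicator {(real k - 1) / 2^j <.. real k / 2^j} x) \<partial>lborel)"
  proof (rule nn_integral_cong)
    fix x :: real
    have *: "{(real k - 1) / 2^j <.. real k / 2^j} \<subseteq> {0..1}" if "k \<in> {1..2^j}" for k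
    proof -
      have "real k \<le> 2^j" using that by (metis atLeastAtMost_iff of_nat_le_iff of_nat_numeral of_nat_power)
      moreover have "(0::real) \<le> (real k - 1) / 2^j" using that by simp
      moreover have "real k / 2^j \<le> 1" using calculation(1) by simp
      ultimately show ?thesis 
        unfolding subset_iff greaterThanAtMost_iff atLeastAtMost_iff by (meson less_imp_le order_trans)
    qed
    have "ennreal (histogram j a x) =
        (\<Sum>k=1..2^j. ennreal (a k * 2^j * indicator {(real k - 1) / 2^j <.. real k / 2^j} x))"
      unfolding histogram_def using nn by (intro sum_ennreal[symmetric]) auto
    moreover have "ennreal (a k * 2^j * indicator {(real k - 1) / 2^j <.. real k / 2^j} x) * indicator {0..1} x =
        ennreal (a k * 2^j) * indicator {(real k - 1) / 2^j <.. real k / 2^j} x"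
      if "k \<in> {1..2^j}" for k
      using *[OF that] by (cases "x \<in> {(real k - 1) / 2^j <.. real k / 2^j}") (simp_all add: subset_iff)
    ultimately show "ennreal (histogram j a x) * indicator {0..1} x =
        (\<Sum>k=1..2^j. ennreal (a k * 2^j) * indicator {(real k - 1) / 2^j <.. real k / 2^j} x)"
      by (simp only: sum_distrib_right) (intro sum.cong; simp)
  qed
  also have "\<dots> = (\<Sum>k=1..2^j. ennreal (a k * 2^j) * ennreal (real k / 2^j - (real k - 1) / 2^j))"
    by (subst nn_integral_sum) (auto simp: nn_integral_cmult divide_right_mono intro!: sum.cong)
  also have "\<dots> = (\<Sum>k=1..2^j. ennreal (a k))"
    using nn by (intro sum.cong refl) (auto simp: ennreal_mult[symmetric] field_simps)
  also have "\<dots> = 1"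
    using nn assms by (subst sum_ennreal) (auto simp: prob_vectors_def)
  finally have "(\<integral>\<^sup>+x. ennreal (histogram j a x) \<partial>unit_interval) = 1" .
  moreover have "0 \<le> histogram j a x" for x
    unfolding histogram_def using nn by (intro sum_nonneg) auto
  ultimately show ?thesis
    by (simp add: densities_def)
qed

lemma Lr_norm_infinity_histogram:
  assumes f: "continuous_on {0..1} f"
  shows "Lr_norm \<infinity> (\<lambda>x. histogram j a x - f x) =
    (SUP x\<in>{0<..1}. ereal \<bar>histogram j a x - f x\<bar>)"
proof -
  define g where "g x = ereal \<bar>histogram j a x - f x\<bar>" for x
  have "f \<in> borel_measurable unit_interval"
    using borel_measurable_continuous_on_restrict[OF f]
    by (simp add: measurable_def sets_restrict_space space_restrict_space)
  then have meas: "g \<in> borel_measurable unit_interval"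
    unfolding g_def by measurable
  have nz: "AE x in lborel. x \<noteq> (0::real)"
    by (rule AE_lborel_singleton)
  have "esssup unit_interval g \<le> (SUP x\<in>{0<..1}. g x)"
    using nz by (intro esssup_I meas) (auto simp: AE_restrict_space_iff intro!: SUP_upper elim!: eventually_mono)
  moreover have "g x \<le> esssup unit_interval g" if x: "x \<in> {0<..1}" for x
  proof (rule ccontr)
    assume "\<not> g x \<le> esssup unit_interval g"
    then have "esssup unit_interval g < g x"
      by (simp add: not_le)
    then obtain t where t: "esssup unit_interval g < ereal t" "ereal t < g x"
      using ereal_dense2 by blast
    obtain k where k: "k \<in> {1..2^j}" "x \<in> {(real k - 1) / 2^j <.. real k / 2^j}"
      using histogram_cell[OF x] .
    define l where "l = max 0 ((real k - 1) / 2^j)"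
    have cell: "histogram j a y = a k * 2^j" "y \<in> {0..1}" if "y \<in> {l<..x}" for y
      using that k x by (auto simp: l_def intro!: histogram_eq)
    have "continuous_on {0..1} (\<lambda>y. \<bar>a k * 2^j - f y\<bar>)"
      by (intro continuous_intros f)
    moreover have "0 < \<bar>a k * 2^j - f x\<bar> - t" "x \<in> {0..1}"
      using t(2) x cell[of x] k by (auto simp: g_def l_def)
    ultimately obtain d where d: "d > 0" and
      dd: "\<And>y. y \<in> {0..1} \<Longrightarrow> dist y x < d \<Longrightarrow>
        dist \<bar>a k * 2^j - f y\<bar> \<bar>a k * 2^j - f x\<bar> < \<bar>a k * 2^j - f x\<bar> - t"
      unfolding continuous_on_iff by metis
    define m where "m = max l (x - d)"
    have "m < x" using d k x by (auto simp: m_def l_def)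
    have big: "y \<in> {0..1} \<and> esssup unit_interval g < g y" if "y \<in> {m<..<x}" for y
    proof -
      have y: "y \<in> {l<..x}" "dist y x < d" using that by (auto simp: m_def dist_real_def)
      then have "t < \<bar>a k * 2^j - f y\<bar>"
        using dd[of y] cell[of y] by (auto simp: dist_real_def)
      then have "ereal t < g y" using cell[of y] y by (simp add: g_def)
      with t(1) y cell[of y] show ?thesis by auto
    qed
    have "AE y in lborel. y \<in> {0..1} \<longrightarrow> g y \<le> esssup unit_interval g"
      using esssup_AE[of g unit_interval] by (simp add: AE_restrict_space_iff)
    then have "AE y in lborel. y \<notin> {m<..<x}"
      by (rule eventually_mono) (use big in \<open>auto simp: not_less[symmetric]\<close>)
    then have "emeasure lborel {m<..<x} = 0"
      by (subst (asm) AE_iff_measurable[OF _ refl]) (auto simp: greaterThanLessThan_eq greaterThan_def lessThan_def Collect_conj_eq)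
    then show False using \<open>m < x\<close> by simp
  qed
  then have "(SUP x\<in>{0<..1}. g x) \<le> esssup unit_interval g"
    by (rule SUP_least)
  ultimately show ?thesis
    by (simp add: Lr_norm_def g_def[abs_def])
qed

text \<open>The law of the random histogram is carried by the largest sigma-algebra on the space of densities
  for which the histogram map is measurable; the image law on any smaller one is its restriction.
  In particular point evaluations and norms of differences are measurable.\<close>

definition histogram_prior :: "nat \<Rightarrow> (real \<Rightarrow> real) measure" where
  "histogram_prior j =
     (let D = dirichlet (2^j) (\<lambda>_. 1)
      in distr D
           (sigma densities {A. A \<subseteq> densities \<and> histogram j -` A \<inter> space D \<in> sets D})
           (histogram j))"

definition posterior ::
    "(real \<Rightarrow> real) measure \<Rightarrow> nat \<Rightarrow> (nat \<Rightarrow> real) \<Rightarrow> (real \<Rightarrow> real) set \<Rightarrow> real" where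
  "posterior Q n X A = (LINT p:A|Q. (\<Prod>i<n. p (X i))) / (LINT p|Q. (\<Prod>i<n. p (X i)))"

definition iid_law :: "(real \<Rightarrow> real) \<Rightarrow> (nat \<Rightarrow> real) measure" where
  "iid_law p0 = PiM UNIV (\<lambda>_. density unit_interval (\<lambda>x. ennreal (p0 x)))"

definition tendsto_in_prob :: "'a measure \<Rightarrow> (nat \<Rightarrow> 'a \<Rightarrow> real) \<Rightarrow> real \<Rightarrow> bool" where
  "tendsto_in_prob M Y c \<longleftrightarrow>
     (\<forall>n. Y n \<in> borel_measurable M) \<and>
     (\<forall>\<epsilon>>0. (\<lambda>n. measure M {\<omega> \<in> space M. \<epsilon> < \<bar>Y n \<omega> - c\<bar>}) \<longlonglongrightarrow> 0)"

end

theory Submission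
  imports Defs
begin

text \<open>The prior is conjugate: given the data, the weights are again Dirichlet distributed, so only second
  moments are needed. With \<open>N = 2\<^sup>j\<close> cells, \<open>\<pi>\<^sub>k\<close> the true mass and \<open>c\<^sub>k\<close> the number of observations in cell \<open>k\<close>,
  the posterior second moment of \<open>a\<^sub>k - \<pi>\<^sub>k\<close> is explicit, and averaging it over the data gives
  \<open>E (\<Sum>\<^sub>k (a\<^sub>k - \<pi>\<^sub>k)\<^sup>2) = O(1 / n)\<close>, that is, a squared \<open>L\<^sup>2\<close>-distance \<open>O(N / n)\<close> of the random histogram to the histogram
  of \<open>p\<^sub>0\<close>. A function that is constant on the cells satisfies \<open>\<parallel>f\<parallel>\<^sub>r \<le> C N powr (1/2 - 1 / max 2 r) \<parallel>f\<parallel>\<^sub>2\<close>, and the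
  histogram of \<open>p\<^sub>0\<close> is within \<open>O(N powr (-\<alpha>))\<close> of \<open>p\<^sub>0\<close> (with an additional factor \<open>log N\<close> in the Zygmund class), so
  the choice of \<open>N\<close> balances the two errors and Markov's inequality concludes; \<open>\<eta> = 2\<close> absorbs all logarithms.\<close>

section \<open>Moments of the Dirichlet distribution\<close>

text \<open>Integration by parts: \<open>F\<close> vanishes at both ends, so one unit of exponent
  moves from \<open>s - x\<close> to \<open>x\<close> at the cost of the factor
  \<open>(b + 1) / (a + 1)\<close>. The induction on \<open>b\<close> therefore has to keep
  \<open>a\<close> arbitrary.\<close>

lemma has_integral_power_mult_power:
  fixes s :: real
  assumes "0 \<le> s"
  shows "((\<lambda>x. x ^ a * (s - x) ^ b) has_integral
           fact a * fact b / fact (a + b + 1) * s ^ (a + b + 1)) {0..s}"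
proof (induction b arbitrary: a)
  case 0
  have "((\<lambda>x. x ^ a) has_integral s ^ (a + 1) / real (a + 1) - 0 ^ (a + 1) / real (a + 1)) {0..s}"
    using assms by (intro fundamental_theorem_of_calculus)
      (auto simp: has_real_derivative_iff_has_vector_derivative[symmetric]
        simp del: power_Suc intro!: derivative_eq_intros)
  moreover have "s ^ (a + 1) / real (a + 1) - 0 ^ (a + 1) / real (a + 1) =
      fact a * fact 0 / fact (a + 0 + 1) * s ^ (a + 0 + 1)"
    by simp
  ultimately show ?case by simp
next
  case (Suc b)
  define F where "F x = x ^ (a + 1) * (s - x) ^ (b + 1)" for x
  have "((\<lambda>x. real (a + 1) * (x ^ a * (s - x) ^ Suc b) - real (b + 1) * (x ^ (a + 1) * (s - x) ^ b))
      has_integral F s - F 0) {0..s}"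
    using assms unfolding F_def by (intro fundamental_theorem_of_calculus)
      (auto simp: has_real_derivative_iff_has_vector_derivative[symmetric] algebra_simps
        simp del: power_Suc intro!: derivative_eq_intros)
  moreover have "F s - F 0 = 0" by (simp add: F_def)
  ultimately have "((\<lambda>x. (real (a + 1) * (x ^ a * (s - x) ^ Suc b) - real (b + 1) * (x ^ (a + 1) * (s - x) ^ b))
        + real (b + 1) * (x ^ (a + 1) * (s - x) ^ b))
      has_integral 0 + real (b + 1) * (fact (a + 1) * fact b / fact (a + 1 + b + 1) * s ^ (a + 1 + b + 1))) {0..s}"
    by (intro has_integral_add has_integral_mult_right Suc.IH) simp
  then have "((\<lambda>x. (1 / real (a + 1)) * (real (a + 1) * (x ^ a * (s - x) ^ Suc b)))
      has_integral (1 / real (a + 1)) * (real (b + 1) * (fact (a + 1) * fact b / fact (a + 1 + b + 1) * s ^ (a + 1 + b + 1)))) {0..s}"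
    by (intro has_integral_mult_right) simp
  moreover have "(1 / real (a + 1)) * (real (b + 1) * (fact (a + 1) * fact b / fact (a + 1 + b + 1) * s ^ (a + 1 + b + 1)))
      = fact a * fact (Suc b) / fact (a + Suc b + 1) * s ^ (a + Suc b + 1)"
    by (simp add: divide_simps del: of_nat_Suc)
  ultimately show ?case
    by (simp only:) simp
qed

text \<open>The open interval matches the strict inequalities in \<open>dirichlet_density\<close>;
  the two endpoints form a null set.\<close>

lemma nn_integral_power_mult_power:
  fixes s :: real
  assumes "0 \<le> s"
  shows "(\<integral>\<^sup>+x. ennreal (if 0 < x \<and> x < s then x ^ a * (s - x) ^ b else 0) \<partial>lborel) =
    ennreal (fact a * fact b / fact (a + b + 1) * s ^ (a + b + 1))"
proof -
  have "(\<integral>\<^sup>+x. ennreal (if 0 < x \<and> x < s then x ^ a * (s - x) ^ b else 0) \<partial>lborel) =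
    (\<integral>\<^sup>+x. ennreal (indicator {0..s} x * (x ^ a * (s - x) ^ b)) \<partial>lborel)"
    using AE_lborel_singleton[of 0] AE_lborel_singleton[of s]
    by (intro nn_integral_cong_AE) (auto simp: indicator_def elim!: eventually_elim2)
  also have "\<dots> = ennreal (fact a * fact b / fact (a + b + 1) * s ^ (a + b + 1))"
    using nn_integral_has_integral_lebesgue[OF _ has_integral_power_mult_power[OF assms, of a b]]
    by simp
  finally show ?thesis .
qed

text \<open>The Dirichlet integral, by splitting off one coordinate. With \<open>x i = y\<close>
  fixed, the other coordinates range over a simplex of size \<open>s - y\<close>, and the induction
  hypothesis leaves a Beta integral in \<open>y\<close> with exponents \<open>c i\<close> and
  \<open>m\<close>. Hence \<open>s\<close> is arbitrary, and the case \<open>s\<close> \<le> 0,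
  where the region is empty, belongs to the statement.\<close>

lemma nn_integral_simplex:
  fixes s :: real and c :: "'i \<Rightarrow> nat"
  assumes "finite K"
  shows "(\<integral>\<^sup>+x. ennreal (if (\<forall>k\<in>K. 0 < x k) \<and> (\<Sum>k\<in>K. x k) < s
             then (\<Prod>k\<in>K. x k ^ c k) * (s - (\<Sum>k\<in>K. x k)) ^ b else 0) \<partial>PiM K (\<lambda>_. lborel)) =
    ennreal (if 0 < s then (\<Prod>k\<in>K. fact (c k)) * fact b / fact (card K + b + (\<Sum>k\<in>K. c k))
               * s ^ (card K + b + (\<Sum>k\<in>K. c k)) else 0)"
  using assms
proof (induction K arbitrary: s rule: finite_induct)
  case empty
  interpret product_sigma_finite "\<lambda>_::'i. lborel :: real measure" ..
  show ?case
    by (subst nn_integral_empty) auto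
next
  case (insert i K)
  interpret product_sigma_finite "\<lambda>_::'i. lborel :: real measure" ..
  let ?P = "PiM K (\<lambda>_. lborel :: real measure)"
  define m where "m = card K + b + (\<Sum>k\<in>K. c k)"
  define C :: real where "C = (\<Prod>k\<in>K. fact (c k)) * fact b / fact m"
  have C: "0 \<le> C" by (simp add: C_def prod_nonneg)
  have "(\<integral>\<^sup>+x. ennreal (if (\<forall>k\<in>insert i K. 0 < x k) \<and> (\<Sum>k\<in>insert i K. x k) < s
       then (\<Prod>k\<in>insert i K. x k ^ c k) * (s - (\<Sum>k\<in>insert i K. x k)) ^ b else 0) \<partial>PiM (insert i K) (\<lambda>_. lborel)) =
     (\<integral>\<^sup>+y. (\<integral>\<^sup>+x. (\<lambda>x. ennreal (if (\<forall>k\<in>insert i K. 0 < x k) \<and> (\<Sum>k\<in>insert i K. x k) < s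
       then (\<Prod>k\<in>insert i K. x k ^ c k) * (s - (\<Sum>k\<in>insert i K. x k)) ^ b else 0)) (x(i := y)) \<partial>?P) \<partial>lborel)"
    using insert.hyps by (intro product_nn_integral_insert_rev) measurable
  also have "\<dots> = (\<integral>\<^sup>+y. ennreal C * ennreal (if 0 < y \<and> y < s then y ^ c i * (s - y) ^ m else 0) \<partial>lborel)"
  proof (rule nn_integral_cong)
    fix y :: real
    have upd: "(\<Sum>k\<in>K. (x(i := y)) k) = (\<Sum>k\<in>K. x k)" "(\<Prod>k\<in>K. (x(i := y)) k ^ c k) = (\<Prod>k\<in>K. x k ^ c k)"
        "(\<forall>k\<in>K. 0 < (x(i := y)) k) \<longleftrightarrow> (\<forall>k\<in>K. 0 < x k)" for x :: "'i \<Rightarrow> real"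
      using insert.hyps by (auto intro!: sum.cong prod.cong)
    have "(\<integral>\<^sup>+x. (\<lambda>x. ennreal (if (\<forall>k\<in>insert i K. 0 < x k) \<and> (\<Sum>k\<in>insert i K. x k) < s
       then (\<Prod>k\<in>insert i K. x k ^ c k) * (s - (\<Sum>k\<in>insert i K. x k)) ^ b else 0)) (x(i := y)) \<partial>?P) =
      (\<integral>\<^sup>+x. ennreal (if 0 < y then y ^ c i else 0) * ennreal (if (\<forall>k\<in>K. 0 < x k) \<and> (\<Sum>k\<in>K. x k) < s - y
             then (\<Prod>k\<in>K. x k ^ c k) * (s - y - (\<Sum>k\<in>K. x k)) ^ b else 0) \<partial>?P)"
      using insert.hyps
      by (intro nn_integral_cong)
        (auto simp: upd less_diff_eq add.commute diff_diff_eq ennreal_mult'' [symmetric] prod_nonneg less_imp_le mult.assoc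
           simp del: fun_upd_apply simp: fun_upd_same)
    also have "\<dots> = ennreal (if 0 < y then y ^ c i else 0) *
        ennreal (if 0 < s - y then C * (s - y) ^ m else 0)"
      unfolding C_def m_def insert.IH[of "s - y", symmetric]
      using \<open>finite K\<close> by (intro nn_integral_cmult) measurable
    also have "\<dots> = ennreal C * ennreal (if 0 < y \<and> y < s then y ^ c i * (s - y) ^ m else 0)"
      using C by (auto simp: ennreal_mult''[symmetric] ennreal_mult'[symmetric] algebra_simps)
    finally show "(\<integral>\<^sup>+x. (\<lambda>x. ennreal (if (\<forall>k\<in>insert i K. 0 < x k) \<and> (\<Sum>k\<in>insert i K. x k) < s
       then (\<Prod>k\<in>insert i K. x k ^ c k) * (s - (\<Sum>k\<in>insert i K. x k)) ^ b else 0)) (x(i := y)) \<partial>?P) = \<dots>" .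
  qed
  also have "\<dots> = ennreal C * (\<integral>\<^sup>+y. ennreal (if 0 < y \<and> y < s then y ^ c i * (s - y) ^ m else 0) \<partial>lborel)"
    by (rule nn_integral_cmult) measurable
  also have "\<dots> = ennreal (if 0 < s then (\<Prod>k\<in>insert i K. fact (c k)) * fact b / fact (card (insert i K) + b + (\<Sum>k\<in>insert i K. c k))
               * s ^ (card (insert i K) + b + (\<Sum>k\<in>insert i K. c k)) else 0)"
  proof (cases "0 < s")
    case True
    have "c i + m + 1 = card (insert i K) + b + (\<Sum>k\<in>insert i K. c k)"
      using insert.hyps by (simp add: m_def)
    then show ?thesis
      using True insert.hyps C by (subst nn_integral_power_mult_power)
        (simp_all add: ennreal_mult'[symmetric] C_def m_def field_simps del: fact_Suc)
  next
    case False
    then have "(\<lambda>y. ennreal (if 0 < y \<and> y < s then y ^ c i * (s - y) ^ m else 0)) = (\<lambda>_. 0)" by auto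
    with False show ?thesis by (simp only:) simp
  qed
  finally show ?case .
qed

section \<open>The Dirichlet law in coordinates and its monomial moments\<close>

lemma complete_vector_nth:
  "k \<in> {1..<N} \<Longrightarrow> complete_vector N x k = x k"
  "1 \<le> N \<Longrightarrow> complete_vector N x N = 1 - (\<Sum>i=1..<N. x i)"
  by (auto simp: complete_vector_def)

lemma sum_complete_vector: "1 \<le> N \<Longrightarrow> (\<Sum>k=1..N. complete_vector N x k) = 1"
proof -
  assume N: "1 \<le> N"
  then have "{1..N} = insert N {1..<N}" by auto
  then have "(\<Sum>k=1..N. complete_vector N x k) = complete_vector N x N + (\<Sum>k=1..<N. complete_vector N x k)"
    by simp
  also have "(\<Sum>k=1..<N. complete_vector N x k) = (\<Sum>k=1..<N. x k)"
    by (intro sum.cong) (auto simp: complete_vector_nth)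
  finally show ?thesis using N by (simp add: complete_vector_nth)
qed

lemma measurable_complete_vector [measurable]:
  "complete_vector N \<in> PiM {1..<N} (\<lambda>_. lborel) \<rightarrow>\<^sub>M PiM {1..N} (\<lambda>_. borel)"
  unfolding complete_vector_def
proof (rule measurable_restrict)
  fix k assume "k \<in> {1..N}"
  show "(\<lambda>x. if k < N then x k else 1 - (\<Sum>i=1..<N. x i)) \<in> PiM {1..<N} (\<lambda>_. lborel) \<rightarrow>\<^sub>M borel"
    using \<open>k \<in> {1..N}\<close> by (cases "k < N") auto
qed

lemma prob_vectors_eq:
  "prob_vectors N = {a \<in> space (PiM {1..N} (\<lambda>_. borel)). (\<forall>k\<in>{1..N}. 0 \<le> a k) \<and> (\<Sum>k=1..N. a k) = 1}"
  by (auto simp: prob_vectors_def space_PiM PiE_def)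

lemma sets_prob_vectors [measurable]: "prob_vectors N \<in> sets (PiM {1..N} (\<lambda>_. borel))"
  unfolding prob_vectors_eq by measurable

lemma space_dirichlet: "space (dirichlet N \<theta>) = prob_vectors N"
  by (auto simp: dirichlet_def space_restrict_space prob_vectors_eq)

lemma sets_dirichlet [measurable_cong]:
  "sets (dirichlet N \<theta>) = sets (restrict_space (PiM {1..N} (\<lambda>_. borel)) (prob_vectors N))"
  by (simp add: dirichlet_def sets_restrict_space)

lemma borel_measurable_dirichletI:
  "f \<in> borel_measurable (PiM {1..N} (\<lambda>_. borel)) \<Longrightarrow> f \<in> borel_measurable (dirichlet N \<theta>)"
  by (simp add: measurable_cong_sets[OF sets_dirichlet refl] measurable_restrict_space1)

text \<open>With all parameters one the law is uniform on the simplex. In the free coordinates the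
  last component contributes the power \<open>c N\<close> of the slack \<open>1 - sum\<close>, so
  this is the simplex integral with \<open>s = 1\<close> and \<open>b = c N\<close>.\<close>

lemma nn_integral_dirichlet_monomial:
  fixes c :: "nat \<Rightarrow> nat"
  assumes N: "1 \<le> N"
  shows "(\<integral>\<^sup>+a. ennreal (\<Prod>k=1..N. a k ^ c k) \<partial>dirichlet N (\<lambda>_. 1)) =
    ennreal (fact (N - 1) * (\<Prod>k=1..N. fact (c k)) / fact (N - 1 + (\<Sum>k=1..N. c k)))"
proof -
  let ?P = "PiM {1..<N} (\<lambda>_. lborel :: real measure)" and ?B = "PiM {1..N} (\<lambda>_. borel :: real measure)"
  let ?d = "\<lambda>x. ennreal (dirichlet_density N (\<lambda>_. 1) (complete_vector N x))"
  let ?f = "\<lambda>a. ennreal (\<Prod>k=1..N. a k ^ c k)"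
  have split: "{1..N} = insert N {1..<N}" "N \<notin> {1..<N}" using N by auto
  \<comment> \<open>The powers have exponent zero and the normalising constant is
    \<open>Gamma N\<close>, a factorial.\<close>
  have dd: "dirichlet_density N (\<lambda>_. 1) a = (if \<forall>k\<in>{1..N}. 0 < a k then fact (N - 1) else 0)" for a
    using N Gamma_fact[of "N - 1", where ?'a = real]
    by (auto simp: dirichlet_density_def of_nat_diff add.commute intro!: prod.neutral)
  have [measurable]: "dirichlet_density N (\<lambda>_. 1) \<in> borel_measurable ?B"
    unfolding dd by measurable
  have cv_measurable: "complete_vector N \<in> density ?P ?d \<rightarrow>\<^sub>M ?B"
    by measurable
  have "(\<integral>\<^sup>+a. ?f a \<partial>dirichlet N (\<lambda>_. 1)) =
      (\<integral>\<^sup>+a. ?f a * indicator (prob_vectors N) a \<partial>distr (density ?P ?d) ?B (complete_vector N))"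
    unfolding dirichlet_def
    by (subst nn_integral_restrict_space) (auto simp del: One_nat_def)
  also have "\<dots> = (\<integral>\<^sup>+x. ?f (complete_vector N x) * indicator (prob_vectors N) (complete_vector N x) \<partial>density ?P ?d)"
    by (subst nn_integral_distr[OF cv_measurable]) measurable
  also have "\<dots> = (\<integral>\<^sup>+x. ?d x * (?f (complete_vector N x) * indicator (prob_vectors N) (complete_vector N x)) \<partial>?P)"
    by (subst nn_integral_density; measurable)
  also have "\<dots> = (\<integral>\<^sup>+x. ennreal (fact (N - 1)) * ennreal (if (\<forall>k\<in>{1..<N}. 0 < x k) \<and> (\<Sum>k\<in>{1..<N}. x k) < 1
             then (\<Prod>k\<in>{1..<N}. x k ^ c k) * (1 - (\<Sum>k\<in>{1..<N}. x k)) ^ c N else 0) \<partial>?P)"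
  proof (rule nn_integral_cong)
    fix x
    have prod: "(\<Prod>k=1..N. complete_vector N x k ^ c k) = (\<Prod>k\<in>{1..<N}. x k ^ c k) * (1 - (\<Sum>k\<in>{1..<N}. x k)) ^ c N"
      unfolding split(1) prod.insert[OF finite_atLeastLessThan split(2)]
      using N prod.cong[OF refl, of "{1..<N}" "\<lambda>k. complete_vector N x k ^ c k" "\<lambda>k. x k ^ c k"]
      by (simp only: complete_vector_nth mult.commute)
    have pos: "(\<forall>k\<in>{1..N}. 0 < complete_vector N x k) \<longleftrightarrow> (\<forall>k\<in>{1..<N}. 0 < x k) \<and> (\<Sum>k\<in>{1..<N}. x k) < 1"
      unfolding split(1) using N by (auto simp: complete_vector_nth)
    \<comment> \<open>On the support of the density the indicator left by
      \<open>restrict_space\<close> equals one; off the support the density kills the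
      integrand.\<close>
    have "complete_vector N x \<in> prob_vectors N" if "\<forall>k\<in>{1..N}. 0 < complete_vector N x k"
      using that sum_complete_vector[OF N, of x]
      by (auto simp: prob_vectors_def less_imp_le) (simp add: complete_vector_def)
    then show "?d x * (?f (complete_vector N x) * indicator (prob_vectors N) (complete_vector N x)) =
        ennreal (fact (N - 1)) * ennreal (if (\<forall>k\<in>{1..<N}. 0 < x k) \<and> (\<Sum>k\<in>{1..<N}. x k) < 1
             then (\<Prod>k\<in>{1..<N}. x k ^ c k) * (1 - (\<Sum>k\<in>{1..<N}. x k)) ^ c N else 0)"
      unfolding dd prod pos by auto
  qed
  also have "\<dots> = ennreal (fact (N - 1)) * ennreal ((\<Prod>k\<in>{1..<N}. fact (c k)) * fact (c N) / fact (card {1..<N} + c N + (\<Sum>k\<in>{1..<N}. c k)))"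
  proof (subst nn_integral_cmult)
    show "(\<lambda>x. ennreal (if (\<forall>k\<in>{1..<N}. 0 < x k) \<and> (\<Sum>k\<in>{1..<N}. x k) < 1
        then (\<Prod>k\<in>{1..<N}. x k ^ c k) * (1 - (\<Sum>k\<in>{1..<N}. x k)) ^ c N else 0)) \<in> borel_measurable ?P"
      by measurable
  qed (subst nn_integral_simplex, simp_all del: One_nat_def)
  also have "\<dots> = ennreal (fact (N - 1) * (\<Prod>k=1..N. fact (c k)) / fact (N - 1 + (\<Sum>k=1..N. c k)))"
    unfolding split(1) prod.insert[OF finite_atLeastLessThan split(2)] sum.insert[OF finite_atLeastLessThan split(2)]
    by (simp add: ennreal_mult'[symmetric] mult_ac add_ac)
  finally show ?thesis .
qed

lemma has_bochner_integral_dirichlet_monomial: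
  fixes c :: "nat \<Rightarrow> nat"
  assumes N: "1 \<le> N"
  shows "has_bochner_integral (dirichlet N (\<lambda>_. 1)) (\<lambda>a. \<Prod>k=1..N. a k ^ c k)
    (fact (N - 1) * (\<Prod>k=1..N. fact (c k)) / fact (N - 1 + (\<Sum>k=1..N. c k)))"
proof (rule has_bochner_integral_nn_integral)
  show "(\<lambda>a. \<Prod>k=1..N. a k ^ c k) \<in> borel_measurable (dirichlet N (\<lambda>_. 1))"
    by (rule borel_measurable_dirichletI) measurable
  show "AE a in dirichlet N (\<lambda>_. 1). 0 \<le> (\<Prod>k=1..N. a k ^ c k)"
    by (rule AE_I2) (auto simp: space_dirichlet prob_vectors_def intro!: prod_nonneg)
qed (auto simp: nn_integral_dirichlet_monomial[OF N] simp del: One_nat_def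
      intro!: divide_nonneg_nonneg mult_nonneg_nonneg prod_nonneg)

section \<open>The posterior\<close>

text \<open>This is the final sigma-algebra of \<open>h\<close>. Since the generating family is
  already closed, \<open>sigma\<close> adds no sets in \<open>histogram_prior\<close>, and
  measurability there can be tested on preimages alone.\<close>

lemma sigma_algebra_vimage_sets:
  assumes "h \<in> space D \<rightarrow> \<Omega>"
  shows "sigma_algebra \<Omega> {A. A \<subseteq> \<Omega> \<and> h -` A \<inter> space D \<in> sets D}"
proof (rule sigma_algebra_iff2[THEN iffD2], intro conjI ballI allI impI)
  fix A assume A: "A \<in> {A. A \<subseteq> \<Omega> \<and> h -` A \<inter> space D \<in> sets D}"
  have "h -` (\<Omega> - A) \<inter> space D = space D - (h -` A \<inter> space D)"
    using assms by auto
  with A show "\<Omega> - A \<in> {A. A \<subseteq> \<Omega> \<and> h -` A \<inter> space D \<in> sets D}"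
    by auto
next
  fix A :: "nat \<Rightarrow> _" assume A: "range A \<subseteq> {A. A \<subseteq> \<Omega> \<and> h -` A \<inter> space D \<in> sets D}"
  have "h -` (\<Union>i. A i) \<inter> space D = (\<Union>i. h -` A i \<inter> space D)"
    by auto
  moreover have "(\<Union>i. h -` A i \<inter> space D) \<in> sets D"
    using A by (intro sets.countable_UN) auto
  ultimately show "(\<Union>i. A i) \<in> {A. A \<subseteq> \<Omega> \<and> h -` A \<inter> space D \<in> sets D}"
    using A by auto
qed auto

text \<open>No measurability of \<open>g\<close> is needed: the sigma-algebra of the prior is so large that \<open>g\<close> is measurable
  whenever its composition with the histogram map is, and otherwise both integrals are \<open>0\<close>.\<close>

lemma integral_histogram_prior:
  fixes g :: "(real \<Rightarrow> real) \<Rightarrow> real"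
  shows "(\<integral>p. g p \<partial>histogram_prior j) = (\<integral>a. g (histogram j a) \<partial>dirichlet (2 ^ j) (\<lambda>_. 1))"
proof -
  define D where "D = dirichlet (2 ^ j) (\<lambda>_. 1)"
  define S where "S = {A. A \<subseteq> densities \<and> histogram j -` A \<inter> space D \<in> sets D}"
  have h: "histogram j \<in> space D \<rightarrow> densities"
    using histogram_in_densities by (auto simp: D_def space_dirichlet)
  interpret sigma_algebra densities S
    unfolding S_def by (rule sigma_algebra_vimage_sets[OF h])
  have Q: "histogram_prior j = distr D (sigma densities S) (histogram j)"
    by (simp add: histogram_prior_def D_def S_def Let_def)
  have sets_S: "sets (sigma densities S) = S" and space_S: "space (sigma densities S) = densities"
    using space_closed by (simp_all add: sigma_sets_eq)
  have hm: "histogram j \<in> D \<rightarrow>\<^sub>M sigma densities S"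
    by (intro measurableI, unfold sets_S space_S) (use h in \<open>auto simp: S_def\<close>)
  show ?thesis
  proof (cases "g \<in> borel_measurable (sigma densities S)")
    case True
    then show ?thesis
      unfolding Q D_def[symmetric] by (rule integral_distr[OF hm])
  next
    case False
    have "(\<lambda>a. g (histogram j a)) \<notin> borel_measurable D"
    proof
      assume m: "(\<lambda>a. g (histogram j a)) \<in> borel_measurable D"
      have "g \<in> borel_measurable (sigma densities S)"
      proof (rule measurableI)
        fix B :: "real set" assume "B \<in> sets borel"
        from measurable_sets[OF m this] have "(\<lambda>a. g (histogram j a)) -` B \<inter> space D \<in> sets D" .
        also have "(\<lambda>a. g (histogram j a)) -` B \<inter> space D = histogram j -` (g -` B \<inter> densities) \<inter> space D"
          using h by auto
        finally show "g -` B \<inter> space (sigma densities S) \<in> sets (sigma densities S)"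
          unfolding sets_S space_S by (auto simp: S_def)
      qed simp
      with False show False by simp
    qed
    then have "\<not> integrable D (\<lambda>a. g (histogram j a))"
      by (auto dest: borel_measurable_integrable)
    moreover have "\<not> integrable (histogram_prior j) g"
      using False by (auto simp: Q dest!: borel_measurable_integrable)
    ultimately show ?thesis
      by (simp add: not_integrable_integral_eq D_def)
  qed
qed

text \<open>Division by the normalising constant \<open>m\<close> gives posterior moments: the
  weights have a Dirichlet law with parameters \<open>c k + 1\<close> and total \<open>T\<close>.
  Its first two moments are the quotients in the conclusion, read off from ratios of
  factorials.\<close>

lemma has_bochner_integral_dirichlet_quadratic:
  fixes c :: "nat \<Rightarrow> nat" and x :: real
  assumes N: "1 \<le> N" and i: "i \<in> {1..N}"
  defines "m \<equiv> fact (N - 1) * (\<Prod>k=1..N. fact (c k)) / fact (N - 1 + (\<Sum>k=1..N. c k))"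
    and "T \<equiv> real N + real (\<Sum>k=1..N. c k)"
  shows "has_bochner_integral (dirichlet N (\<lambda>_. 1)) (\<lambda>a. (a i - x)\<^sup>2 * (\<Prod>k=1..N. a k ^ c k))
    (m * ((real (c i) + 1) * (real (c i) + 2) / (T * (T + 1)) - 2 * x * ((real (c i) + 1) / T) + x\<^sup>2))"
proof -
  let ?D = "dirichlet N (\<lambda>_. 1)" and ?C = "{1..N} - {i}"
  define s where "s = (\<Sum>k=1..N. c k)"
  have fin: "finite {1..N}" by simp
  have T: "T = real (N - 1 + s) + 1" and T_pos: "T > 0"
    using N by (simp_all add: T_def s_def of_nat_diff del: of_nat_sum)
  \<comment> \<open>A factor \<open>a i ^ e\<close> only raises the exponent at \<open>i\<close>, so
    the integrand is again a monomial; \<open>e = 0, 1, 2\<close> yields all three terms of the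
    expanded square.\<close>
  have upd: "has_bochner_integral ?D (\<lambda>a. a i ^ e * (\<Prod>k=1..N. a k ^ c k))
      (fact (N - 1) * (fact (c i + e) * (\<Prod>k\<in>?C. fact (c k))) / fact (N - 1 + (s + e)))" for e
  proof -
    let ?c = "c(i := c i + e)"
    have "(\<Prod>k=1..N. a k ^ ?c k) = a i ^ e * (\<Prod>k=1..N. a k ^ c k)" for a :: "nat \<Rightarrow> real"
      unfolding prod.remove[OF fin i] by (simp add: power_add mult_ac cong: prod.cong_simp)
    moreover have "(\<Prod>k=1..N. fact (?c k)) = fact (c i + e) * (\<Prod>k\<in>?C. fact (c k) :: real)"
      unfolding prod.remove[OF fin i] by (auto intro!: prod.cong)
    moreover have "(\<Sum>k=1..N. ?c k) = s + e"
      unfolding s_def sum.remove[OF fin i] by (auto intro!: sum.cong)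
    ultimately show ?thesis
      using has_bochner_integral_dirichlet_monomial[OF N, of ?c] by simp
  qed
  have m: "m = fact (N - 1) * (fact (c i) * (\<Prod>k\<in>?C. fact (c k))) / fact (N - 1 + s)"
    unfolding m_def s_def prod.remove[OF fin i] by simp
  have m0: "has_bochner_integral ?D (\<lambda>a. \<Prod>k=1..N. a k ^ c k) m"
    using upd[of 0] unfolding m by simp
  have "fact (N - 1 + (s + 1)) = T * (fact (N - 1 + s) :: real)"
    by (simp add: T)
  then have m1: "has_bochner_integral ?D (\<lambda>a. a i * (\<Prod>k=1..N. a k ^ c k)) (m * ((real (c i) + 1) / T))"
    using upd[of 1] unfolding m by (simp add: mult_ac add_ac)
  have "fact (N - 1 + (s + 2)) = T * (T + 1) * (fact (N - 1 + s) :: real)"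
    by (simp add: T add_ac numeral_2_eq_2)
  moreover have "fact (c i + 2) = (real (c i) + 1) * (real (c i) + 2) * fact (c i)"
    by (simp add: add_ac numeral_2_eq_2)
  ultimately have m2: "has_bochner_integral ?D (\<lambda>a. a i ^ 2 * (\<Prod>k=1..N. a k ^ c k))
      (m * ((real (c i) + 1) * (real (c i) + 2) / (T * (T + 1))))"
    using upd[of 2] unfolding m by (simp add: mult_ac)
  have "has_bochner_integral ?D
     (\<lambda>a. a i ^ 2 * (\<Prod>k=1..N. a k ^ c k) - 2 * x * (a i * (\<Prod>k=1..N. a k ^ c k)) + x\<^sup>2 * (\<Prod>k=1..N. a k ^ c k))
     (m * ((real (c i) + 1) * (real (c i) + 2) / (T * (T + 1))) - 2 * x * (m * ((real (c i) + 1) / T)) + x\<^sup>2 * m)"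
    by (intro has_bochner_integral_add has_bochner_integral_diff has_bochner_integral_mult_right m0 m1 m2)
  then show ?thesis
    by (simp add: power2_eq_square algebra_simps)
qed

section \<open>Dyadic cells and the likelihood of the counts\<close>

abbreviation cell :: "nat \<Rightarrow> nat \<Rightarrow> real set" where
  "cell j k \<equiv> {(real k - 1) / 2 ^ j <.. real k / 2 ^ j}"

text \<open>For positive \<open>x\<close> this numbers the half-open cell around \<open>x\<close>.
  All \<open>x\<close> \<le> 0 get index 0 because \<open>nat\<close> truncates; within the unit
  interval this singles out the point 0, which lies in none of the cells
  \<open>1..2 ^ j\<close>.\<close>

definition cell_index :: "nat \<Rightarrow> real \<Rightarrow> nat" where
  "cell_index j x = nat \<lceil>x * 2 ^ j\<rceil>"

definition cell_count :: "nat \<Rightarrow> nat \<Rightarrow> (nat \<Rightarrow> real) \<Rightarrow> nat \<Rightarrow> nat" where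
  "cell_count j n X k = card {i \<in> {..<n}. X i \<in> cell j k}"

lemma cell_index_eq_iff:
  assumes "1 \<le> k"
  shows "cell_index j x = k \<longleftrightarrow> x \<in> cell j k"
proof -
  have "cell_index j x = k \<longleftrightarrow> \<lceil>x * 2 ^ j\<rceil> = int k"
    using assms by (auto simp: cell_index_def)
  also have "\<dots> \<longleftrightarrow> x \<in> cell j k"
    by (auto simp: ceiling_eq_iff field_simps)
  finally show ?thesis .
qed

lemma cell_index_in: "x \<in> {0<..1} \<Longrightarrow> cell_index j x \<in> {1..2 ^ j}"
  by (metis atLeastAtMost_iff cell_index_eq_iff histogram_cell)

text \<open>The data enter a histogram only through an integer, which later makes measurability in
  the data a discrete matter.\<close>

lemma histogram_cell_index:
  assumes "x \<in> {0..1}"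
  shows "histogram j a x = (if cell_index j x = 0 then 0 else a (cell_index j x) * 2 ^ j)"
proof (cases "x = 0")
  case True
  then show ?thesis
    by (auto simp: histogram_def cell_index_def indicator_def field_simps intro!: sum.neutral)
next
  case False
  with assms cell_index_in[of x j] have "cell_index j x \<in> {1..2 ^ j}" by auto
  then show ?thesis
    using cell_index_eq_iff[of "cell_index j x" j x] by (auto intro!: histogram_eq)
qed

lemma sum_cell_count:
  assumes "\<And>i. i < n \<Longrightarrow> X i \<in> {0<..1}"
  shows "(\<Sum>k=1..2 ^ j. cell_count j n X k) = n"
proof -
  have "(\<Sum>k=1..2 ^ j. cell_count j n X k) = (\<Sum>k\<in>{1..2 ^ j}. \<Sum>i\<in>{i \<in> {..<n}. cell_index j (X i) = k}. 1)"
    by (intro sum.cong) (auto simp: cell_count_def cell_index_eq_iff)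
  also have "\<dots> = (\<Sum>i<n. 1)"
    using assms cell_index_in by (intro sum.group) auto
  finally show ?thesis by simp
qed

text \<open>Grouping the observations by cell turns the likelihood into a monomial in the weights.
  This is the source of conjugacy: the counts are sufficient.\<close>

lemma prod_histogram:
  assumes "\<And>i. i < n \<Longrightarrow> X i \<in> {0<..1}"
  shows "(\<Prod>i<n. histogram j a (X i)) = (2 ^ j) ^ n * (\<Prod>k=1..2 ^ j. a k ^ cell_count j n X k)"
proof -
  have "(\<Prod>i<n. histogram j a (X i)) = (\<Prod>i<n. 2 ^ j * a (cell_index j (X i)))"
  proof (rule prod.cong)
    fix i assume "i \<in> {..<n}"
    then have "X i \<in> {0<..1}" using assms by simp
    with cell_index_in[OF this, of j] show "histogram j a (X i) = 2 ^ j * a (cell_index j (X i))"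
      by (subst histogram_cell_index) auto
  qed simp
  also have "\<dots> = (2 ^ j) ^ n * (\<Prod>i<n. a (cell_index j (X i)))"
    by (simp add: prod.distrib)
  also have "(\<Prod>i<n. a (cell_index j (X i))) =
      (\<Prod>k\<in>{1..2 ^ j}. \<Prod>i\<in>{i \<in> {..<n}. cell_index j (X i) = k}. a (cell_index j (X i)))"
    using assms cell_index_in by (intro prod.group[symmetric]) auto
  also have "\<dots> = (\<Prod>k=1..2 ^ j. a k ^ cell_count j n X k)"
  proof (rule prod.cong)
    fix k assume "k \<in> {1..2 ^ j :: nat}"
    then have "{i \<in> {..<n}. cell_index j (X i) = k} = {i \<in> {..<n}. X i \<in> cell j k}"
      using cell_index_eq_iff[of k j] by auto
    then have "a k ^ cell_count j n X k = (\<Prod>i\<in>{i \<in> {..<n}. cell_index j (X i) = k}. a k)"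
      by (simp add: cell_count_def)
    also have "\<dots> = (\<Prod>i\<in>{i \<in> {..<n}. cell_index j (X i) = k}. a (cell_index j (X i)))"
      by (intro prod.cong) auto
    finally show "(\<Prod>i\<in>{i \<in> {..<n}. cell_index j (X i) = k}. a (cell_index j (X i))) = a k ^ cell_count j n X k" ..
  qed simp
  finally show ?thesis .
qed

section \<open>The posterior as a function of the data, and its second moment bound\<close>

lemma posterior_histogram_prior:
  "posterior (histogram_prior j) n X A =
     (\<integral>a. indicator A (histogram j a) * (\<Prod>i<n. histogram j a (X i)) \<partial>dirichlet (2 ^ j) (\<lambda>_. 1)) /
     (\<integral>a. (\<Prod>i<n. histogram j a (X i)) \<partial>dirichlet (2 ^ j) (\<lambda>_. 1))"
  unfolding posterior_def set_lebesgue_integral_def integral_histogram_prior by simp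

text \<open>The posterior factors through the list \<open>Z\<close> of the first \<open>n\<close>
  cell indices. Such lists form a countable set, and every function on a countable discrete space is
  measurable, so the argument covers an arbitrary set \<open>A\<close>.\<close>

lemma borel_measurable_posterior:
  "(\<lambda>X. posterior (histogram_prior j) n X A) \<in> borel_measurable (PiM UNIV (\<lambda>_. density unit_interval f))"
    (is "_ \<in> borel_measurable ?M")
proof -
  \<comment> \<open>Index 0 means an observation at the point 0, where every histogram
    vanishes.\<close>
  define v where "v a k = (if k = 0 then 0 else a k * 2 ^ j)" for a :: "nat \<Rightarrow> real" and k :: nat
  define G where "G l =
     (\<integral>a. indicator A (histogram j a) * (\<Prod>i<n. v a (l ! i)) \<partial>dirichlet (2 ^ j) (\<lambda>_. 1)) /
     (\<integral>a. (\<Prod>i<n. v a (l ! i)) \<partial>dirichlet (2 ^ j) (\<lambda>_. 1))" for l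
  define Z where "Z X = map (\<lambda>i. cell_index j (X i)) [0..<n]" for X
  have ci: "(\<lambda>X. cell_index j (X i)) \<in> ?M \<rightarrow>\<^sub>M count_space UNIV" for i
  proof -
    have "cell_index j \<in> borel \<rightarrow>\<^sub>M count_space UNIV"
      unfolding cell_index_def by measurable
    then have "cell_index j \<in> density unit_interval f \<rightarrow>\<^sub>M count_space UNIV"
      by (simp add: measurable_restrict_space1)
    then show ?thesis
      by (rule measurable_compose[OF measurable_component_singleton[OF UNIV_I]])
  qed
  have "Z -` {l} \<inter> space ?M \<in> sets ?M" for l
  proof -
    have "Z X = l \<longleftrightarrow> length l = n \<and> (\<forall>i<n. cell_index j (X i) = l ! i)" for X
      unfolding Z_def list_eq_iff_nth_eq by auto
    then have "Z -` {l} \<inter> space ?M = {X \<in> space ?M. length l = n \<and> (\<forall>i<n. cell_index j (X i) = l ! i)}"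
      by blast
    also have "\<dots> \<in> sets ?M"
      using ci by measurable
    finally show ?thesis .
  qed
  then have "Z \<in> ?M \<rightarrow>\<^sub>M count_space UNIV"
    by (subst measurable_count_space_eq2_countable) auto
  then have "(\<lambda>X. G (Z X)) \<in> borel_measurable ?M"
    by (rule measurable_compose) simp
  moreover have "posterior (histogram_prior j) n X A = G (Z X)" if X: "X \<in> space ?M" for X
  proof -
    have "X i \<in> {0..1}" for i
      using X by (auto simp: space_PiM space_restrict_space PiE_def Pi_def)
    then have "histogram j a (X i) = v a (Z X ! i)" if "i < n" for a i
      using that by (subst histogram_cell_index) (auto simp: v_def Z_def)
    then show ?thesis
      unfolding posterior_histogram_prior G_def by simp
  qed
  ultimately show ?thesis
    by (subst measurable_cong)
qed

lemma posterior_nonneg: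
  assumes "\<And>i. i < n \<Longrightarrow> X i \<in> {0..1}"
  shows "0 \<le> posterior (histogram_prior j) n X A"
proof -
  have "0 \<le> (\<Prod>i<n. histogram j a (X i))" if "a \<in> prob_vectors (2 ^ j)" for a
    using histogram_in_densities[OF that] assms by (auto simp: densities_def intro!: prod_nonneg)
  then show ?thesis
    unfolding posterior_histogram_prior
    by (intro divide_nonneg_nonneg integral_nonneg_AE AE_I2) (auto simp: space_dirichlet)
qed

text \<open>Chebyshev's inequality under the posterior. The first summand is the squared distance of
  the posterior mean \<open>(c k + 1) / T\<close> from the centre, the second bounds the posterior
  variance.\<close>

lemma posterior_le_second_moment:
  fixes \<pi> :: "nat \<Rightarrow> real"
  assumes X: "\<And>i. i < n \<Longrightarrow> X i \<in> {0..1}" and \<delta>: "0 < \<delta>"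
    and A: "\<And>a. a \<in> prob_vectors (2 ^ j) \<Longrightarrow> histogram j a \<in> A \<Longrightarrow> \<delta> \<le> (\<Sum>k=1..2 ^ j. (a k - \<pi> k)\<^sup>2)"
  defines "T \<equiv> 2 ^ j + real n"
  shows "posterior (histogram_prior j) n X A \<le>
    (\<Sum>k=1..2 ^ j. ((real (cell_count j n X k) + 1) / T - \<pi> k)\<^sup>2 + (real (cell_count j n X k) + 1) / T\<^sup>2) / \<delta>"
    (is "_ \<le> (\<Sum>k=1..2 ^ j. ?V k) / \<delta>")
proof -
  let ?D = "dirichlet (2 ^ j) (\<lambda>_. 1)" and ?c = "cell_count j n X" and ?N = "2 ^ j :: nat"
  have T: "T > 0" by (simp add: T_def add_pos_nonneg)
  have V: "0 \<le> ?V k" for k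
    using T by (intro add_nonneg_nonneg divide_nonneg_nonneg) auto
  show ?thesis
  proof (cases "\<exists>i<n. X i = 0")
    \<comment> \<open>An observation at 0 annihilates the likelihood of every histogram. The
      posterior is then \<open>0 / 0\<close>, which is 0, and the bound is trivial.\<close>
    case True
    then have "(\<Prod>i<n. histogram j a (X i)) = 0" for a
      using histogram_cell_index[of 0 j a] by (intro prod_zero) (auto simp: cell_index_def intro!: bexI)
    then have "posterior (histogram_prior j) n X A = 0"
      unfolding posterior_histogram_prior by (simp only:) simp
    then show ?thesis
      using V \<delta> by (auto intro!: divide_nonneg_pos sum_nonneg)
  next
    case False
    with X have X': "X i \<in> {0<..1}" if "i < n" for i
      using that by (force simp: less_le)
    \<comment> \<open>Up to the factor \<open>(2 ^ j) ^ n\<close> this is the marginal likelihood;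
      it cancels between numerator and denominator.\<close>
    define m :: real where "m = fact (?N - 1) * (\<Prod>k=1..?N. fact (?c k)) / fact (?N - 1 + n)"
    have m_pos: "m > 0" unfolding m_def by (intro divide_pos_pos mult_pos_pos prod_pos) auto
    define mom where "mom k = (real (?c k) + 1) * (real (?c k) + 2) / (T * (T + 1)) - 2 * \<pi> k * ((real (?c k) + 1) / T) + (\<pi> k)\<^sup>2" for k
    \<comment> \<open>Replacing \<open>T + 1\<close> by \<open>T\<close> in the denominator
      completes the square, with remainder \<open>b / T\<^sup>2\<close>.\<close>
    have mom_le: "mom k \<le> ?V k" for k
    proof -
      define b where "b = real (?c k) + 1"
      have b: "b > 0" by (simp add: b_def)
      have "b * (b + 1) / (T * (T + 1)) \<le> b * (b + 1) / (T * T)"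
        using b T by (intro divide_left_mono) auto
      then have "mom k \<le> b * (b + 1) / (T * T) - 2 * \<pi> k * (b / T) + (\<pi> k)\<^sup>2"
        by (simp add: mom_def b_def add_ac)
      also have "\<dots> = ?V k"
        unfolding b_def[symmetric] using T by (simp add: power2_eq_square field_simps)
      finally show ?thesis .
    qed
    have lik: "(\<Prod>i<n. histogram j a (X i)) = (2 ^ j) ^ n * (\<Prod>k=1..?N. a k ^ ?c k)" for a
      by (rule prod_histogram) (rule X')
    have count: "(\<Sum>k=1..?N. ?c k) = n"
      by (rule sum_cell_count) (rule X')
    have den: "(\<integral>a. (\<Prod>i<n. histogram j a (X i)) \<partial>?D) = (2 ^ j) ^ n * m"
      using has_bochner_integral_dirichlet_monomial[of ?N ?c]
      unfolding lik count m_def[symmetric] by (simp add: has_bochner_integral_iff)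
    have quad: "has_bochner_integral ?D (\<lambda>a. (a k - \<pi> k)\<^sup>2 * (\<Prod>k=1..?N. a k ^ ?c k)) (m * mom k)"
      if "k \<in> {1..?N}" for k
      using has_bochner_integral_dirichlet_quadratic[OF _ that, where c = ?c and x = "\<pi> k"]
      unfolding count m_def[symmetric] mom_def T_def by simp
    have num: "has_bochner_integral ?D
        (\<lambda>a. (2 ^ j) ^ n / \<delta> * (\<Sum>k=1..?N. (a k - \<pi> k)\<^sup>2 * (\<Prod>k=1..?N. a k ^ ?c k)))
        ((2 ^ j) ^ n / \<delta> * (\<Sum>k=1..?N. m * mom k))"
      by (intro has_bochner_integral_mult_right has_bochner_integral_sum quad)
    have "(\<integral>a. indicator A (histogram j a) * (\<Prod>i<n. histogram j a (X i)) \<partial>?D) \<le>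
       (\<integral>a. (2 ^ j) ^ n / \<delta> * (\<Sum>k=1..?N. (a k - \<pi> k)\<^sup>2 * (\<Prod>k=1..?N. a k ^ ?c k)) \<partial>?D)"
    \<comment> \<open>Integrability is required of the majorant only. If the left integrand is not
      integrable, its integral is 0, which the nonnegative majorant still dominates; this admits
      every \<open>A\<close>.\<close>
    proof (rule integral_mono')
      fix a assume "a \<in> space ?D"
      then have a: "a \<in> prob_vectors ?N" by (simp add: space_dirichlet)
      define P where "P = (\<Prod>k=1..?N. a k ^ ?c k)"
      define E where "E = (\<Sum>k=1..?N. (a k - \<pi> k)\<^sup>2)"
      have P: "0 \<le> P" using a unfolding P_def by (intro prod_nonneg) (auto simp: prob_vectors_def)
      have E: "0 \<le> E" unfolding E_def by (intro sum_nonneg) auto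
      have eq: "(2 ^ j) ^ n / \<delta> * (\<Sum>k=1..?N. (a k - \<pi> k)\<^sup>2 * (\<Prod>k=1..?N. a k ^ ?c k)) = (2 ^ j) ^ n * P * (E / \<delta>)"
        unfolding P_def[symmetric] E_def sum_distrib_right[symmetric] by simp
      show "0 \<le> (2 ^ j) ^ n / \<delta> * (\<Sum>k=1..?N. (a k - \<pi> k)\<^sup>2 * (\<Prod>k=1..?N. a k ^ ?c k))"
        unfolding eq using P E \<delta> by simp
      have "indicator A (histogram j a) \<le> E / \<delta>"
        using A[OF a] \<delta> E unfolding E_def[symmetric] by (auto simp: indicator_def)
      then have "(2 ^ j) ^ n * P * indicator A (histogram j a) \<le> (2 ^ j) ^ n * P * (E / \<delta>)"
        using P by (intro mult_left_mono) auto
      then show "indicator A (histogram j a) * (\<Prod>i<n. histogram j a (X i)) \<le>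
          (2 ^ j) ^ n / \<delta> * (\<Sum>k=1..?N. (a k - \<pi> k)\<^sup>2 * (\<Prod>k=1..?N. a k ^ ?c k))"
        unfolding eq lik unfolding P_def[symmetric] by (simp add: mult_ac)
    qed (use num in \<open>simp add: has_bochner_integral_iff\<close>)
    also have "\<dots> = (2 ^ j) ^ n / \<delta> * (\<Sum>k=1..?N. m * mom k)"
      using num by (simp only: has_bochner_integral_iff)
    also have "\<dots> = ((\<Sum>k=1..?N. mom k) / \<delta>) * ((2 ^ j) ^ n * m)"
      by (simp add: sum_distrib_left[symmetric])
    finally have "posterior (histogram_prior j) n X A \<le> (\<Sum>k=1..?N. mom k) / \<delta>"
      unfolding posterior_histogram_prior den using m_pos by (simp add: pos_divide_le_eq)
    also have "\<dots> \<le> (\<Sum>k=1..?N. ?V k) / \<delta>"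
      using mom_le \<delta> by (intro divide_right_mono sum_mono) auto
    finally show ?thesis by simp
  qed
qed

section \<open>Norms and approximation by histograms\<close>

text \<open>Division by the total weight \<open>W\<close> reduces this to a probability vector,
  whose histogram is a density; hence the positive sum.\<close>

lemma nn_integral_histogram:
  assumes nonneg: "\<And>k. k \<in> {1..2 ^ j} \<Longrightarrow> 0 \<le> b k" and pos: "0 < (\<Sum>k=1..2 ^ j. b k)"
  shows "(\<integral>\<^sup>+x. ennreal (histogram j b x) \<partial>unit_interval) = ennreal (\<Sum>k=1..2 ^ j. b k)"
proof -
  define W where "W = (\<Sum>k=1..2 ^ j. b k)"
  define d where "d = (\<lambda>k\<in>{1..2 ^ j}. b k / W)"
  have W: "0 < W" using pos by (simp add: W_def)
  have "(\<Sum>k=1..2 ^ j. d k) = W / W"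
    unfolding W_def sum_divide_distrib by (intro sum.cong) (auto simp: d_def W_def)
  moreover have "\<forall>k\<in>{1..2 ^ j}. 0 \<le> d k" "d \<in> extensional {1..2 ^ j}"
    using W nonneg by (auto simp: d_def)
  ultimately have d: "d \<in> prob_vectors (2 ^ j)"
    using W by (simp add: prob_vectors_def)
  have "histogram j b x = W * histogram j d x" for x
    unfolding histogram_def sum_distrib_left using W by (intro sum.cong) (auto simp: d_def)
  then have "(\<integral>\<^sup>+x. ennreal (histogram j b x) \<partial>unit_interval) =
      (\<integral>\<^sup>+x. ennreal W * ennreal (histogram j d x) \<partial>unit_interval)"
    using W by (simp add: ennreal_mult')
  also have "\<dots> = ennreal W * (\<integral>\<^sup>+x. ennreal (histogram j d x) \<partial>unit_interval)"
    by (intro nn_integral_cmult) measurable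
  also have "(\<integral>\<^sup>+x. ennreal (histogram j d x) \<partial>unit_interval) = 1"
    using histogram_in_densities[OF d] by (simp add: densities_def)
  finally show ?thesis by (simp add: W_def)
qed

lemma AE_unit_interval_pos: "AE x in unit_interval. x \<in> {0<..1}"
  using AE_lborel_singleton[of "0 :: real"]
  by (auto simp: AE_restrict_space_iff elim!: eventually_mono)

text \<open>For \<open>s\<close> \<ge> 2 every term is bounded by \<open>D\<close>, so
  \<open>s\<close>-th powers are controlled by squares after scaling with \<open>D\<close>, and
  \<open>D powr s\<close> is \<open>N * u powr s\<close>. For \<open>s < 2\<close> the inequality
  \<open>t powr s\<close> \<le> \<open>1 + t\<^sup>2\<close> costs the factor 2.\<close>

lemma sum_powr_le_of_sum_power2_le:
  fixes h :: "'a \<Rightarrow> real" and s u :: real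
  assumes K: "finite K" and N: "N = real (card K)" "0 < N" and s: "1 \<le> s" and u: "0 < u"
    and h: "(\<Sum>k\<in>K. (h k)\<^sup>2) \<le> (N powr (1 / max 2 s) * u)\<^sup>2"
  shows "(\<Sum>k\<in>K. \<bar>h k\<bar> powr s) \<le> 2 * N * u powr s"
proof (cases "2 \<le> s")
  case True
  define D where "D = N powr (1 / s) * u"
  have D: "0 < D" using u N by (simp add: D_def)
  have hD: "(\<Sum>k\<in>K. (h k)\<^sup>2) \<le> D\<^sup>2" using h True by (simp add: D_def max_def)
  have "\<bar>h k\<bar> powr s \<le> D powr s * ((h k)\<^sup>2 / D\<^sup>2)" if k: "k \<in> K" for k
  proof -
    have "(h k)\<^sup>2 \<le> (\<Sum>k\<in>K. (h k)\<^sup>2)"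
      using K k by (intro member_le_sum) auto
    with hD have "\<bar>h k\<bar> \<le> D" using D by (metis abs_le_square_iff abs_of_pos order_trans)
    then have t: "0 \<le> \<bar>h k\<bar> / D" "\<bar>h k\<bar> / D \<le> 1" using D by auto
    have "(\<bar>h k\<bar> / D) powr s \<le> (\<bar>h k\<bar> / D) powr 2"
      using t True by (intro powr_mono')
    also have "\<dots> = (h k)\<^sup>2 / D\<^sup>2"
      using t D by (simp add: power_divide)
    finally have "D powr s * (\<bar>h k\<bar> / D) powr s \<le> D powr s * ((h k)\<^sup>2 / D\<^sup>2)"
      by (intro mult_left_mono) auto
    then show ?thesis using D by (simp add: powr_divide)
  qed
  then have "(\<Sum>k\<in>K. \<bar>h k\<bar> powr s) \<le> D powr s * ((\<Sum>k\<in>K. (h k)\<^sup>2) / D\<^sup>2)"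
    unfolding sum_divide_distrib sum_distrib_left by (rule sum_mono)
  also have "\<dots> \<le> D powr s * 1"
    using hD D by (intro mult_left_mono) auto
  also have "D powr s = N * u powr s"
    using N u s by (simp add: D_def powr_mult powr_powr)
  also have "N * u powr s * 1 \<le> 2 * N * u powr s"
    using N by simp
  finally show ?thesis .
next
  case False
  have "\<bar>h k\<bar> powr s \<le> u powr s * (1 + (h k)\<^sup>2 / u\<^sup>2)" for k
  proof -
    define t where "t = \<bar>h k\<bar> / u"
    have t: "0 \<le> t" using u by (simp add: t_def)
    have "t powr s \<le> 1 + t\<^sup>2"
    proof (cases "t \<le> 1")
      case True
      then have "t powr s \<le> 1" using t s by (simp add: powr_le1)
      then show ?thesis by (simp add: add_increasing2)
    next
      case False
      then have "t powr s \<le> t powr 2" using \<open>\<not> 2 \<le> s\<close> by (intro powr_mono) auto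
      then show ?thesis using t by simp
    qed
    then have "u powr s * t powr s \<le> u powr s * (1 + t\<^sup>2)"
      by (intro mult_left_mono) auto
    then show ?thesis using u by (simp add: t_def powr_divide power_divide)
  qed
  then have "(\<Sum>k\<in>K. \<bar>h k\<bar> powr s) \<le> (\<Sum>k\<in>K. u powr s * (1 + (h k)\<^sup>2 / u\<^sup>2))"
    by (intro sum_mono) auto
  also have "\<dots> = u powr s * (N + (\<Sum>k\<in>K. (h k)\<^sup>2) / u\<^sup>2)"
    unfolding sum_distrib_left[symmetric] sum.distrib sum_divide_distrib[symmetric] by (simp add: N)
  also have "\<dots> \<le> u powr s * (N + N)"
  proof -
    have "(N powr (1 / max 2 s) * u)\<^sup>2 = N * u\<^sup>2"
      using False N by (simp add: max_def power_mult_distrib powr_half_sqrt)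
    with h have "(\<Sum>k\<in>K. (h k)\<^sup>2) / u\<^sup>2 \<le> N"
      using u by (simp add: pos_divide_le_eq)
    then show ?thesis by (intro mult_left_mono) auto
  qed
  finally show ?thesis by (simp add: mult_ac)
qed

text \<open>In the application \<open>q\<close> consists of the cell averages of \<open>p0\<close>.\<close>

lemma Lr_norm_histogram_diff_le:
  fixes q p0 :: "_ \<Rightarrow> real" and r :: ereal
  defines "\<beta> \<equiv> real_of_ereal (1 / max 2 r)"
  assumes r: "1 \<le> r" and p0 [measurable]: "p0 \<in> borel_measurable unit_interval" and u: "0 < u"
    and close: "\<And>k x. k \<in> {1..2 ^ j} \<Longrightarrow> x \<in> cell j k \<Longrightarrow> \<bar>q k - p0 x\<bar> \<le> u"
    and sum: "(\<Sum>k=1..2 ^ j. (2 ^ j * a k - q k)\<^sup>2) \<le> ((2 ^ j) powr \<beta> * u)\<^sup>2"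
  shows "Lr_norm r (\<lambda>x. histogram j a x - p0 x) \<le> ereal (6 * u)"
proof -
  define h where "h k = 2 ^ j * a k - q k" for k
  define i where "i x = cell_index j x" for x
  have i: "i x \<in> {1..2 ^ j}" "x \<in> cell j (i x)" if "x \<in> {0<..1}" for x
    using cell_index_in[OF that, of j] cell_index_eq_iff[of "i x" j x] unfolding i_def by auto
  have pointwise: "\<bar>histogram j a x - p0 x\<bar> \<le> \<bar>h (i x)\<bar> + u" if "x \<in> {0<..1}" for x
    using close[OF i[OF that]] histogram_eq[OF i[OF that], of a]
    by (simp add: h_def mult.commute)
  show ?thesis
  proof (cases "r = \<infinity>")
    \<comment> \<open>Here the exponent of \<open>2 ^ j\<close> is zero, and each single coefficient
      is dominated by the square sum.\<close>
    case True
    then have "\<beta> = 0" by (simp add: \<beta>_def max_def)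
    have "\<bar>h k\<bar> \<le> u" if "k \<in> {1..2 ^ j}" for k
    proof -
      have "(h k)\<^sup>2 \<le> (\<Sum>k=1..2 ^ j. (h k)\<^sup>2)"
        using that by (intro member_le_sum) auto
      also have "\<dots> \<le> u\<^sup>2" using sum \<open>\<beta> = 0\<close> by (simp add: h_def)
      finally show ?thesis using u by (metis abs_le_square_iff abs_of_pos)
    qed
    then have "\<bar>histogram j a x - p0 x\<bar> \<le> 6 * u" if "x \<in> {0<..1}" for x
      using pointwise[OF that] i(1)[OF that] u by fastforce
    then have "AE x in unit_interval. ereal \<bar>histogram j a x - p0 x\<bar> \<le> ereal (6 * u)"
      by (intro eventually_mono[OF AE_unit_interval_pos]) simp
    then show ?thesis
      using True by (simp add: Lr_norm_def esssup_I)
  next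
    case False
    with r obtain s where s: "r = ereal s" "1 \<le> s"
      by (cases r) auto
    have \<beta>: "\<beta> = 1 / max 2 s"
    proof -
      have "max 2 (ereal s) = ereal (max 2 s)"
        by (metis ereal_max numeral_eq_ereal)
      then have "1 / max 2 (ereal s) = ereal (1 / max 2 s)"
        by (simp only: one_ereal_def) (simp add: max_def)
      then show ?thesis by (simp add: \<beta>_def s)
    qed
    \<comment> \<open>The weights are chosen so that their histogram dominates the integrand, by
      \<open>(v + w) powr s\<close> \<le> \<open>2 powr s * (v powr s + w powr s)\<close>. The
      integral then becomes a finite sum.\<close>
    define b where "b k = 2 powr s * (\<bar>h k\<bar> powr s + u powr s) / 2 ^ j" for k
    have b_pos: "0 < b k" for k
      using u unfolding b_def by (intro divide_pos_pos mult_pos_pos add_nonneg_pos) auto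
    define I where "I = (\<integral>\<^sup>+x. ennreal (\<bar>histogram j a x - p0 x\<bar> powr s) \<partial>unit_interval)"
    have "I \<le> (\<integral>\<^sup>+x. ennreal (histogram j b x) \<partial>unit_interval)"
      unfolding I_def
    proof (rule nn_integral_mono_AE, rule eventually_mono[OF AE_unit_interval_pos])
      fix x :: real assume x: "x \<in> {0<..1}"
      have "\<bar>histogram j a x - p0 x\<bar> powr s \<le> (2 * max \<bar>h (i x)\<bar> u) powr s"
        using pointwise[OF x] s by (intro powr_mono2) auto
      also have "\<dots> \<le> 2 powr s * (\<bar>h (i x)\<bar> powr s + u powr s)"
        using u by (auto simp: powr_mult max_def)
      also have "\<dots> = histogram j b x"
        using histogram_eq[OF i[OF x], of b] by (simp add: b_def)
      finally show "ennreal (\<bar>histogram j a x - p0 x\<bar> powr s) \<le> ennreal (histogram j b x)"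
        by (rule ennreal_leI)
    qed
    also have "\<dots> = ennreal (\<Sum>k=1..2 ^ j. b k)"
      using b_pos by (intro nn_integral_histogram sum_pos) (auto intro: less_imp_le)
    also have "(\<Sum>k=1..2 ^ j. b k) = 2 powr s * ((\<Sum>k=1..2 ^ j. \<bar>h k\<bar> powr s) + 2 ^ j * u powr s) / 2 ^ j"
      unfolding b_def sum_divide_distrib[symmetric] sum_distrib_left[symmetric] sum.distrib by simp
    also have "ennreal \<dots> \<le> ennreal ((6 * u) powr s)"
    \<comment> \<open>The constant 6 is 2 times 3: the 2 comes from splitting the power, the 3 from
      twice \<open>u powr s\<close> for the coefficients plus once for the approximation error, with
      3 \<le> \<open>3 powr s\<close>.\<close>
    proof (rule ennreal_leI)
      have "(\<Sum>k=1..2 ^ j. \<bar>h k\<bar> powr s) \<le> 2 * 2 ^ j * u powr s"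
        using sum u s by (intro sum_powr_le_of_sum_power2_le) (auto simp: h_def \<beta>)
      then have "2 powr s * ((\<Sum>k=1..2 ^ j. \<bar>h k\<bar> powr s) + 2 ^ j * u powr s) / 2 ^ j \<le>
          2 powr s * (2 * 2 ^ j * u powr s + 2 ^ j * u powr s) / 2 ^ j"
        by (intro divide_right_mono mult_left_mono add_right_mono) auto
      also have "\<dots> = 2 powr s * (3 * u powr s)"
        by (simp add: field_simps)
      also have "\<dots> \<le> 2 powr s * (3 powr s * u powr s)"
        using powr_mono[of 1 s "3 :: real"] s by (intro mult_left_mono mult_right_mono) auto
      also have "\<dots> = (6 * u) powr s"
        using u by (simp add: powr_mult[symmetric])
      finally show "2 powr s * ((\<Sum>k=1..2 ^ j. \<bar>h k\<bar> powr s) + 2 ^ j * u powr s) / 2 ^ j \<le> (6 * u) powr s" .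
    qed
    finally have I: "I \<le> ennreal ((6 * u) powr s)" .
    then have "enn2real I \<le> (6 * u) powr s"
      by (intro enn2real_leI) auto
    then have "enn2real I powr (1 / s) \<le> ((6 * u) powr s) powr (1 / s)"
      using s by (intro powr_mono2) auto
    also have "\<dots> = 6 * u" using s u by (simp add: powr_powr)
    finally have "enn2real I powr (1 / s) \<le> 6 * u" .
    moreover have "I \<noteq> \<infinity>" using I by (auto simp: top_unique)
    ultimately show ?thesis
      using s by (simp add: Lr_norm_def Let_def I_def[symmetric])
  qed
qed

section \<open>Moduli of continuity in the smoothness classes\<close>

text \<open>Twice the increment with step \<open>h\<close> is the increment with step \<open>2 * h\<close> up to a second difference; \<open>h\<close> may be
  negative, so that both directions are covered.\<close>

lemma zygmund_doubling:
  fixes f :: "real \<Rightarrow> real"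
  assumes L: "\<And>x h. x - h \<in> {0..1} \<Longrightarrow> x + h \<in> {0..1} \<Longrightarrow> \<bar>f (x + h) - 2 * f x + f (x - h)\<bar> \<le> L * \<bar>h\<bar>"
    and B: "\<And>x. x \<in> {0..1} \<Longrightarrow> \<bar>f x\<bar> \<le> B"
    and x: "x \<in> {0..1}"
  shows "x + 2 ^ m * h \<in> {0..1} \<Longrightarrow> \<bar>f (x + h) - f x\<bar> \<le> 2 * B / 2 ^ m + real m * L * \<bar>h\<bar> / 2"
proof (induction m arbitrary: h)
  case 0
  then show ?case using B[of x] B[of "x + h"] x by auto
next
  case (Suc m)
  have IH: "\<bar>f (x + 2 * h) - f x\<bar> \<le> 2 * B / 2 ^ m + real m * L * \<bar>2 * h\<bar> / 2"
    using Suc.prems by (intro Suc.IH) (simp add: mult_ac)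
  \<comment> \<open>The point \<open>x + 2 * h\<close> lies between \<open>x\<close> and
    \<open>x + 2 ^ Suc m * h\<close>, hence in the interval. Equal sign and smaller modulus express
    this for either direction of \<open>h\<close>.\<close>
  have "\<bar>2 * h\<bar> \<le> \<bar>2 ^ Suc m * h\<bar>" by (simp add: abs_mult mult_right_mono)
  moreover have "0 \<le> 2 * h \<longleftrightarrow> 0 \<le> 2 ^ Suc m * h"
    by (metis mult_le_cancel_left_pos mult_zero_right zero_less_numeral zero_less_power)
  moreover have "0 \<le> x + 2 * h \<and> x + 2 * h \<le> 1"
    if "\<bar>2 * h\<bar> \<le> \<bar>t\<bar>" "0 \<le> 2 * h \<longleftrightarrow> 0 \<le> t" "0 \<le> x + t" "x + t \<le> 1" for t
    using that x by auto
  ultimately have "x + 2 * h \<in> {0..1}"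
    using Suc.prems unfolding atLeastAtMost_iff by blast
  then have "\<bar>f (x + h + h) - 2 * f (x + h) + f (x + h - h)\<bar> \<le> L * \<bar>h\<bar>"
    using x by (intro L) (auto simp: algebra_simps)
  then have "\<bar>f (x + 2 * h) - 2 * f (x + h) + f x\<bar> \<le> L * \<bar>h\<bar>"
    by (simp add: algebra_simps)
  moreover have "2 * \<bar>q - p\<bar> \<le> a + b" if "\<bar>w - p\<bar> \<le> a" "\<bar>w - 2 * q + p\<bar> \<le> b" for w p q a b :: real
    using that abs_triangle_ineq4[of "w - p" "w - 2 * q + p"] abs_mult[of 2 "q - p"] by (simp add: algebra_simps)
  ultimately have "2 * \<bar>f (x + h) - f x\<bar> \<le> 2 * B / 2 ^ m + real m * L * \<bar>2 * h\<bar> / 2 + L * \<bar>h\<bar>"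
    using IH by blast
  also have "\<dots> = 2 * (2 * B / 2 ^ Suc m + real (Suc m) * L * \<bar>h\<bar> / 2)"
    by (simp add: field_simps abs_mult)
  finally show ?case by simp
qed

text \<open>Doubling \<open>j - 1\<close> times stretches the increment to length at most 1/2, where
  boundedness of \<open>f\<close> takes over. Each doubling adds one second difference term, whence
  the factor linear in \<open>j\<close>, a logarithm of the cell width.\<close>

lemma zygmund_modulus:
  fixes f :: "real \<Rightarrow> real"
  assumes L: "\<And>x h. x - h \<in> {0..1} \<Longrightarrow> x + h \<in> {0..1} \<Longrightarrow> \<bar>f (x + h) - 2 * f x + f (x - h)\<bar> \<le> L * \<bar>h\<bar>"
    and B: "\<And>x. x \<in> {0..1} \<Longrightarrow> \<bar>f x\<bar> \<le> B" and L0: "0 \<le> L"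
    and x: "x \<in> {0..1}" and y: "y \<in> {0..1}" and xy: "\<bar>x - y\<bar> \<le> 1 / 2 ^ j"
  shows "\<bar>f x - f y\<bar> \<le> (4 * B + L) * (real j + 1) / 2 ^ j"
proof (cases j)
  case 0
  then show ?thesis using B[OF x] B[OF y] L0 by auto
next
  case (Suc m)
  have B0: "0 \<le> B" using B[OF x] by linarith
  have *: "\<bar>f x - f y\<bar> \<le> (4 * B + L) * (real j + 1) / 2 ^ j"
    if "x \<le> y" and x: "x \<in> {0..1}" and y: "y \<in> {0..1}" and xy: "\<bar>x - y\<bar> \<le> 1 / 2 ^ j" for x y
  proof -
    have "2 ^ m * (y - x) \<le> 2 ^ m * (1 / 2 ^ j)"
      using xy that(1) by (intro mult_left_mono) auto
    then have half: "2 ^ m * (y - x) \<le> 1 / 2" using Suc by simp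
    have "0 \<le> 2 ^ m * (y - x)" using \<open>x \<le> y\<close> by simp
    have "\<bar>f x - f y\<bar> \<le> 2 * B / 2 ^ m + real m * L * \<bar>y - x\<bar> / 2"
    \<comment> \<open>A stretch of length at most 1/2 must stay in the interval: it goes right from
      \<open>x\<close> in the left half, and otherwise left from \<open>y\<close>, which is then
      above 1/2 as well.\<close>
    proof (cases "x \<le> 1 / 2")
      case True
      then have "x + 2 ^ m * (y - x) \<in> {0..1}"
        using half x \<open>0 \<le> 2 ^ m * (y - x)\<close> by auto
      from zygmund_doubling[OF L B x this] show ?thesis by simp
    next
      case False
      have "2 ^ m * (x - y) = - (2 ^ m * (y - x))" by (simp add: algebra_simps)
      then have "0 \<le> y + 2 ^ m * (x - y)" "y + 2 ^ m * (x - y) \<le> 1"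
        using half y False \<open>x \<le> y\<close> \<open>0 \<le> 2 ^ m * (y - x)\<close> unfolding atLeastAtMost_iff by linarith+
      then have "y + 2 ^ m * (x - y) \<in> {0..1}" by simp
      from zygmund_doubling[OF L B y this] show ?thesis by (simp add: abs_minus_commute)
    qed
    also have "real m * L * \<bar>y - x\<bar> / 2 \<le> real m * L * (1 / 2 ^ j) / 2"
      using xy L0 by (intro divide_right_mono mult_left_mono) auto
    also have "2 * B / 2 ^ m + real m * L * (1 / 2 ^ j) / 2 = (4 * B + real m * L / 2) / 2 ^ j"
      using Suc by (simp add: field_simps)
    also have "\<dots> \<le> ((4 * B + L) * (real j + 1)) / 2 ^ j"
    proof (rule divide_right_mono)
      have "4 * B \<le> 4 * B * (real j + 1)" using B0 by (simp add: algebra_simps)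
      moreover have "real m * L / 2 \<le> L * (real j + 1)"
        using L0 Suc by (simp add: algebra_simps)
      ultimately show "4 * B + real m * L / 2 \<le> (4 * B + L) * (real j + 1)"
        by (simp add: algebra_simps)
    qed simp
    finally show ?thesis by simp
  qed
  show ?thesis
  proof (cases "x \<le> y")
    case True
    then show ?thesis using * x y xy by blast
  next
    case False
    then show ?thesis using *[of y x] x y xy by (simp add: abs_minus_commute)
  qed
qed

text \<open>A single modulus at dyadic scales for both branches of \<open>holder_class\<close>: the
  factor \<open>real j + 1\<close> is the Zygmund logarithm and is at least one, so it also
  dominates the Hoelder bound.\<close>

lemma holder_class_modulus:
  assumes f: "f \<in> holder_class \<alpha>" and \<alpha>: "0 < \<alpha>"
  obtains C where "0 < C" and "\<And>j x y. x \<in> {0..1} \<Longrightarrow> y \<in> {0..1} \<Longrightarrow> \<bar>x - y\<bar> \<le> 1 / 2 ^ j \<Longrightarrow>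
      \<bar>f x - f y\<bar> \<le> C * (real j + 1) * (1 / 2 ^ j) powr \<alpha>"
proof (cases "\<alpha> = 1")
  case True
  with f obtain L where cont: "continuous_on {0..1} f" and
    L: "\<And>x h. x - h \<in> {0..1} \<Longrightarrow> x + h \<in> {0..1} \<Longrightarrow> \<bar>f (x + h) - 2 * f x + f (x - h)\<bar> \<le> L * \<bar>h\<bar>"
    by (auto simp: holder_class_def)
  have "bounded (f ` {0..1})"
    by (intro compact_imp_bounded compact_continuous_image cont) auto
  then obtain B where "\<forall>x\<in>{0..1}. \<bar>f x\<bar> \<le> B"
    unfolding bounded_iff by auto
  then have B: "\<And>x. x \<in> {0..1} \<Longrightarrow> \<bar>f x\<bar> \<le> B"
    by blast
  have L': "\<bar>f (x + h) - 2 * f x + f (x - h)\<bar> \<le> \<bar>L\<bar> * \<bar>h\<bar>" if "x - h \<in> {0..1}" "x + h \<in> {0..1}" for x h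
    using L[OF that] by (meson abs_ge_self abs_ge_zero mult_right_mono order_trans)
  have "0 \<le> B" using B[of 0] by auto
  show ?thesis
  proof (rule that)
    show "0 < 4 * B + \<bar>L\<bar> + 1" using \<open>0 \<le> B\<close> by auto
    fix j :: nat and x y :: real
    assume xy: "x \<in> {0..1}" "y \<in> {0..1}" "\<bar>x - y\<bar> \<le> 1 / 2 ^ j"
    have "\<bar>f x - f y\<bar> \<le> (4 * B + \<bar>L\<bar>) * (real j + 1) / 2 ^ j"
      by (rule zygmund_modulus[OF L' B abs_ge_zero xy])
    also have "\<dots> \<le> (4 * B + \<bar>L\<bar> + 1) * (real j + 1) / 2 ^ j"
      by (intro divide_right_mono mult_right_mono) auto
    finally show "\<bar>f x - f y\<bar> \<le> (4 * B + \<bar>L\<bar> + 1) * (real j + 1) * (1 / 2 ^ j) powr \<alpha>"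
      using True by simp
  qed
next
  case False
  with f obtain L where "\<forall>x\<in>{0..1}. \<forall>y\<in>{0..1}. \<bar>f x - f y\<bar> \<le> L * \<bar>x - y\<bar> powr \<alpha>"
    by (auto simp: holder_class_def)
  then have L: "\<And>x y. x \<in> {0..1} \<Longrightarrow> y \<in> {0..1} \<Longrightarrow> \<bar>f x - f y\<bar> \<le> L * \<bar>x - y\<bar> powr \<alpha>"
    by blast
  show ?thesis
  proof (rule that)
    show "0 < \<bar>L\<bar> + 1" by auto
    fix j :: nat and x y :: real
    assume xy: "x \<in> {0..1}" "y \<in> {0..1}" "\<bar>x - y\<bar> \<le> 1 / 2 ^ j"
    note L[OF xy(1,2)]
    also have "L * \<bar>x - y\<bar> powr \<alpha> \<le> (\<bar>L\<bar> + 1) * (real j + 1) * (1 / 2 ^ j) powr \<alpha>"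
    proof (intro mult_mono powr_mono2)
      have "L \<le> (\<bar>L\<bar> + 1) * 1" by auto
      also have "\<dots> \<le> (\<bar>L\<bar> + 1) * (real j + 1)" by (intro mult_left_mono) auto
      finally show "L \<le> (\<bar>L\<bar> + 1) * (real j + 1)" .
    qed (use \<alpha> xy in auto)
    finally show "\<bar>f x - f y\<bar> \<le> (\<bar>L\<bar> + 1) * (real j + 1) * (1 / 2 ^ j) powr \<alpha>" .
  qed
qed

section \<open>Concentration of the posterior\<close>

text \<open>The binomial variance: the square is expanded into a double sum of covariances, and
  independence kills the off-diagonal ones.\<close>

lemma iid_count_variance:
  fixes P :: "'a measure" and n :: nat
  assumes "prob_space P" and A [measurable]: "A \<in> sets P"
  defines "M \<equiv> PiM (UNIV :: nat set) (\<lambda>_. P)" and "p \<equiv> measure P A"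
  shows "has_bochner_integral M (\<lambda>X. (real (card {i \<in> {..<n}. X i \<in> A}) - real n * p)\<^sup>2) (real n * (p - p\<^sup>2))"
proof -
  interpret base: prob_space P by fact
  interpret product_prob_space "\<lambda>_ :: nat. P" UNIV
    by (intro product_prob_spaceI) fact
  interpret M: prob_space M
    unfolding M_def by (rule prob_space_PiM) (rule base.prob_space_axioms)
  \<comment> \<open>The product runs over the set \<open>{i, l}\<close>, which collapses for
    \<open>i = l\<close>; it is thus \<open>p\<close> on the diagonal and \<open>p\<^sup>2\<close>
    off it.\<close>
  have pair: "has_bochner_integral M (\<lambda>X. indicator A (X i) * indicator A (X l)) (\<Prod>i\<in>{i, l}. p)" for i l
  proof -
    let ?E = "{X \<in> space M. \<forall>k\<in>{i, l}. X k \<in> A}"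
    have E: "emeasure M ?E = ennreal (\<Prod>i\<in>{i, l}. p)"
      unfolding M_def by (subst emeasure_PiM_Collect) (auto simp: p_def base.emeasure_eq_measure ennreal_power)
    have "?E \<in> sets M"
      unfolding M_def by measurable
    then have "has_bochner_integral M (indicator ?E :: _ \<Rightarrow> real) (measure M ?E)"
      using E by (intro has_bochner_integral_real_indicator) auto
    moreover have "measure M ?E = (\<Prod>i\<in>{i, l}. p)"
      using E by (simp add: measure_def p_def prod_nonneg)
    ultimately show ?thesis
      by (subst has_bochner_integral_cong[where g = "indicator ?E" and N = M]) (auto simp: indicator_def)
  qed
  have single: "has_bochner_integral M (\<lambda>X. indicator A (X i)) p" for i
    using pair[of i i] by (simp add: indicator_inter_arith[symmetric])
  have const: "has_bochner_integral M (\<lambda>X. c) c" for c :: real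
    by (simp add: has_bochner_integral_iff M.prob_space)
  have cov: "has_bochner_integral M (\<lambda>X. (indicator A (X i) - p) * (indicator A (X l) - p))
      (if i = l then p - p\<^sup>2 else 0)" for i l
  proof -
    have "has_bochner_integral M
       (\<lambda>X. indicator A (X i) * indicator A (X l) - p * indicator A (X i) - p * indicator A (X l) + p\<^sup>2)
       ((\<Prod>i\<in>{i, l}. p) - p * p - p * p + p\<^sup>2)"
      by (intro has_bochner_integral_add has_bochner_integral_diff has_bochner_integral_mult_right pair single const)
    then show ?thesis
      by (cases "i = l") (auto simp: algebra_simps power2_eq_square)
  qed
  have "has_bochner_integral M (\<lambda>X. \<Sum>i<n. \<Sum>l<n. (indicator A (X i) - p) * (indicator A (X l) - p))
      (\<Sum>i<n. \<Sum>l<n. if i = l then p - p\<^sup>2 else 0)"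
    by (intro has_bochner_integral_sum cov)
  moreover have "(\<Sum>i<n. \<Sum>l<n. (indicator A (X i) - p) * (indicator A (X l) - p)) =
      (real (card {i \<in> {..<n}. X i \<in> A}) - real n * p)\<^sup>2" for X :: "nat \<Rightarrow> 'a"
  proof -
    have "(\<Sum>i<n. indicator A (X i) - p) = real (card {i \<in> {..<n}. X i \<in> A}) - real n * p"
      by (simp add: sum_subtractf indicator_def Collect_conj_eq Int_commute sum.If_cases lessThan_def)
    then show ?thesis
      by (simp add: power2_eq_square sum_product[symmetric])
  qed
  ultimately show ?thesis
    by simp
qed

text \<open>An inequality, because observations at 0 belong to no cell; in this form it holds for
  all data without an exceptional null set.\<close>

lemma sum_cell_count_le: "(\<Sum>k=1..2 ^ j. cell_count j n X k) \<le> n"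
proof -
  have "(\<Sum>k=1..2 ^ j. cell_count j n X k) = (\<Sum>k\<in>{1..2 ^ j}. card {i \<in> {..<n}. cell_index j (X i) = k})"
    using cell_index_eq_iff[of _ j] by (intro sum.cong) (auto simp: cell_count_def)
  also have "\<dots> = card (\<Union>k\<in>{1..2 ^ j}. {i \<in> {..<n}. cell_index j (X i) = k})"
    by (intro card_UN_disjoint[symmetric]) auto
  also have "\<dots> \<le> card {..<n}"
    by (intro card_mono) auto
  finally show ?thesis by simp
qed

lemma cell_subset:
  assumes "k \<in> {1..2 ^ j}"
  shows "cell j k \<subseteq> {0..1}"
proof -
  have "real k \<le> 2 ^ j"
    using assms by (metis atLeastAtMost_iff of_nat_le_iff of_nat_numeral of_nat_power)
  then have "real k / 2 ^ j \<le> 1" "0 \<le> (real k - 1) / 2 ^ j"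
    using assms by auto
  then show ?thesis
    unfolding subset_iff greaterThanAtMost_iff atLeastAtMost_iff by (meson less_imp_le order_trans)
qed

lemma cell_length: "real k / 2 ^ j - (real k - 1) / 2 ^ j = 1 / 2 ^ j"
  by (simp add: diff_divide_distrib)

lemma emeasure_cell:
  assumes "k \<in> {1..2 ^ j}"
  shows "cell j k \<in> sets unit_interval" and "emeasure unit_interval (cell j k) = ennreal (1 / 2 ^ j)"
proof -
  show "cell j k \<in> sets unit_interval"
    using cell_subset[OF assms] by (auto simp: sets_restrict_space_iff)
  have "emeasure unit_interval (cell j k) = emeasure lborel (cell j k)"
    using cell_subset[OF assms] by (intro emeasure_restrict_space) auto
  also have "\<dots> = ennreal (1 / 2 ^ j)"
    by (simp add: cell_length divide_right_mono)
  finally show "emeasure unit_interval (cell j k) = ennreal (1 / 2 ^ j)" .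
qed

lemma prob_space_density_unit_interval:
  assumes "p0 \<in> densities"
  shows "prob_space (density unit_interval (\<lambda>x. ennreal (p0 x)))"
proof (rule prob_spaceI)
  have [measurable]: "p0 \<in> borel_measurable unit_interval" using assms by (simp add: densities_def)
  have "emeasure (density unit_interval (\<lambda>x. ennreal (p0 x))) (space unit_interval) = (\<integral>\<^sup>+x. ennreal (p0 x) \<partial>unit_interval)"
    by (subst emeasure_density[OF _ sets.top]) (auto intro!: nn_integral_cong)
  then show "emeasure (density unit_interval (\<lambda>x. ennreal (p0 x)))
      (space (density unit_interval (\<lambda>x. ennreal (p0 x)))) = 1"
    using assms by (simp add: densities_def)
qed

lemma measure_cell_bounds:
  fixes p0 :: "real \<Rightarrow> real"
  assumes p0: "p0 \<in> densities" and k: "k \<in> {1..2 ^ j}"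
    and bounds: "\<And>x. x \<in> cell j k \<Longrightarrow> a \<le> p0 x" "\<And>x. x \<in> cell j k \<Longrightarrow> p0 x \<le> b" and b: "0 \<le> b"
  shows "a / 2 ^ j \<le> measure (density unit_interval (\<lambda>x. ennreal (p0 x))) (cell j k)"
    and "measure (density unit_interval (\<lambda>x. ennreal (p0 x))) (cell j k) \<le> b / 2 ^ j"
proof -
  let ?P = "density unit_interval (\<lambda>x. ennreal (p0 x))"
  interpret prob_space ?P by (rule prob_space_density_unit_interval[OF p0])
  have [measurable]: "p0 \<in> borel_measurable unit_interval" using p0 by (simp add: densities_def)
  note [measurable] = emeasure_cell(1)[OF k]
  have E: "ennreal (measure ?P (cell j k)) = (\<integral>\<^sup>+x. ennreal (p0 x) * indicator (cell j k) x \<partial>unit_interval)"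
    unfolding emeasure_eq_measure[symmetric] by (rule emeasure_density) measurable
  have C: "(\<integral>\<^sup>+x. ennreal c * indicator (cell j k) x \<partial>unit_interval) = ennreal (c / 2 ^ j)" for c
    using emeasure_cell[OF k]
    by (subst nn_integral_cmult_indicator)
       (auto simp: ennreal_mult''[symmetric])
  have "ennreal (measure ?P (cell j k)) \<le> ennreal (b / 2 ^ j)"
    unfolding E C[symmetric] using bounds(2)
    by (intro nn_integral_mono) (auto simp: indicator_def intro: ennreal_leI)
  then show "measure ?P (cell j k) \<le> b / 2 ^ j"
    using b by (subst (asm) ennreal_le_iff) auto
  \<comment> \<open>A negative \<open>a\<close> is truncated to 0 by \<open>ennreal\<close>, so the
    lower bound stays valid in that case.\<close>
  have "ennreal (a / 2 ^ j) \<le> ennreal (measure ?P (cell j k))"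
    unfolding E C[symmetric] using bounds(1)
    by (intro nn_integral_mono) (auto simp: indicator_def intro: ennreal_leI)
  then show "a / 2 ^ j \<le> measure ?P (cell j k)"
    by (subst (asm) ennreal_le_iff) auto
qed

text \<open>Markov's inequality over the data, applied to the second moment bound of the posterior.
  The sampling variances, the pull of the prior and the posterior variances each contribute at most
  a multiple of \<open>T / (T\<^sup>2 * \<delta>)\<close> in expectation.\<close>

lemma posterior_tail_bound:
  fixes p0 :: "real \<Rightarrow> real"
  defines "\<pi> \<equiv> \<lambda>j k. measure (density unit_interval (\<lambda>x. ennreal (p0 x))) (cell j k)"
  assumes p0: "p0 \<in> densities" and B: "\<And>x. x \<in> {0..1} \<Longrightarrow> p0 x \<le> B"
    and n: "0 < n" and \<delta>: "0 < \<delta>" and \<epsilon>: "0 < \<epsilon>"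
    and A: "\<And>a. a \<in> prob_vectors (2 ^ j) \<Longrightarrow> histogram j a \<in> A \<Longrightarrow> \<delta> \<le> (\<Sum>k=1..2 ^ j. (a k - \<pi> j k)\<^sup>2)"
  shows "measure (iid_law p0) {X \<in> space (iid_law p0). \<epsilon> < \<bar>posterior (histogram_prior j) n X A\<bar>} \<le>
    (3 + 2 * B + 2 * B\<^sup>2) / (real n * \<delta> * \<epsilon>)"
proof -
  let ?P = "density unit_interval (\<lambda>x. ennreal (p0 x))" and ?M = "iid_law p0"
  define T where "T = 2 ^ j + real n"
  have T: "0 < T" "real n \<le> T" by (simp_all add: T_def add_pos_nonneg)
  interpret P: prob_space ?P by (rule prob_space_density_unit_interval[OF p0])
  interpret M: prob_space ?M
    unfolding iid_law_def by (rule prob_space_PiM) (rule P.prob_space_axioms)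
  have B0: "0 \<le> B"
    using B[of 0] p0 order_trans[of 0 "p0 0" B] by (simp add: densities_def)
  have \<pi>: "0 \<le> \<pi> j k" "\<pi> j k \<le> B / 2 ^ j" if "k \<in> {1..2 ^ j}" for k
    using measure_cell_bounds(2)[OF p0 that _ _ B0, of 0] cell_subset[OF that] B p0
    by (auto simp: \<pi>_def densities_def subset_iff)
  define V where "V k X = (real (cell_count j n X k) - real n * \<pi> j k)\<^sup>2" for k X
  have V: "has_bochner_integral ?M (V k) (real n * (\<pi> j k - (\<pi> j k)\<^sup>2))" if "k \<in> {1..2 ^ j}" for k
    using iid_count_variance[OF P.prob_space_axioms, of "cell j k" n] emeasure_cell(1)[OF that]
    unfolding V_def[abs_def] cell_count_def iid_law_def \<pi>_def by simp
  \<comment> \<open>A measurable majorant of the posterior probability with explicit expectation.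
    The summand \<open>T\<close> accounts for the posterior variances, since the numbers
    \<open>c k + 1\<close> add up to at most \<open>T\<close>.\<close>
  define W where "W X = ((\<Sum>k=1..2 ^ j. 2 * (V k X + (1 + B\<^sup>2))) + T) / (T\<^sup>2 * \<delta>)" for X
  have V_nonneg: "0 \<le> V k X" for k X by (simp add: V_def)
  have W_nonneg: "0 \<le> W X" for X
    unfolding W_def using T \<delta> V_nonneg
    by (intro divide_nonneg_nonneg add_nonneg_nonneg sum_nonneg mult_nonneg_nonneg) auto
  have W: "has_bochner_integral ?M W
      (((\<Sum>k=1..2 ^ j. 2 * (real n * (\<pi> j k - (\<pi> j k)\<^sup>2) + (1 + B\<^sup>2))) + T) / (T\<^sup>2 * \<delta>))"
  proof -
    have const: "has_bochner_integral ?M (\<lambda>X. c) c" for c :: real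
      by (simp add: has_bochner_integral_iff M.prob_space)
    show ?thesis
      unfolding W_def using V
      by (intro has_bochner_integral_divide_zero has_bochner_integral_add const
          has_bochner_integral_sum has_bochner_integral_mult_right)
  qed
  have post_le: "\<bar>posterior (histogram_prior j) n X A\<bar> \<le> W X" if "X \<in> space ?M" for X
  proof -
    have X: "X i \<in> {0..1}" for i
      using that by (auto simp: iid_law_def space_PiM space_restrict_space PiE_def Pi_def)
    let ?c = "\<lambda>k. real (cell_count j n X k)"
    have "\<bar>posterior (histogram_prior j) n X A\<bar> = posterior (histogram_prior j) n X A"
      using posterior_nonneg[OF X] by simp
    also have "\<dots> \<le> (\<Sum>k=1..2 ^ j. ((?c k + 1) / T - \<pi> j k)\<^sup>2 + (?c k + 1) / T\<^sup>2) / \<delta>"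
      unfolding T_def by (rule posterior_le_second_moment[OF X \<delta> A])
    also have "\<dots> \<le> ((\<Sum>k=1..2 ^ j. 2 * (V k X + (1 + B\<^sup>2)) / T\<^sup>2) + T / T\<^sup>2) / \<delta>"
    proof (rule divide_right_mono)
      have "((?c k + 1) / T - \<pi> j k)\<^sup>2 \<le> 2 * (V k X + (1 + B\<^sup>2)) / T\<^sup>2" if k: "k \<in> {1..2 ^ j}" for k
      proof -
        define v w where "v = ?c k - real n * \<pi> j k" and "w = 2 ^ j * \<pi> j k"
        have w: "0 \<le> w" "w \<le> B" using \<pi>[OF k] by (simp_all add: w_def field_simps)
        \<comment> \<open>Since \<open>T = 2 ^ j + n\<close>, the error of the posterior mean splits
          into the sampling error \<open>v\<close> and the shrinkage \<open>1 - w\<close> towards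
          uniform weights.\<close>
        have "(?c k + 1) / T - \<pi> j k = (v + (1 - w)) / T"
          using T by (simp add: v_def w_def T_def field_simps)
        then have "((?c k + 1) / T - \<pi> j k)\<^sup>2 = (v + (1 - w))\<^sup>2 / T\<^sup>2"
          by (simp add: power_divide)
        also have "\<dots> \<le> (2 * (v\<^sup>2 + (1 + B\<^sup>2))) / T\<^sup>2"
        proof (rule divide_right_mono)
          have "w\<^sup>2 \<le> B\<^sup>2" using w by (intro power_mono) auto
          moreover have "(1 - w)\<^sup>2 = 1 - 2 * w + w\<^sup>2" by (simp add: power2_diff)
          ultimately have sq: "(1 - w)\<^sup>2 \<le> 1 + B\<^sup>2"
            using w(1) by linarith
          have "(v + (1 - w))\<^sup>2 \<le> 2 * (v\<^sup>2 + (1 - w)\<^sup>2)"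
            using zero_le_power2[of "v - (1 - w)"] by (simp add: power2_sum power2_diff)
          also have "\<dots> \<le> 2 * (v\<^sup>2 + (1 + B\<^sup>2))"
            by (intro mult_left_mono add_left_mono sq) simp
          finally show "(v + (1 - w))\<^sup>2 \<le> 2 * (v\<^sup>2 + (1 + B\<^sup>2))" .
        qed simp
        finally show ?thesis by (simp add: V_def v_def)
      qed
      moreover have "(\<Sum>k=1..2 ^ j. (?c k + 1) / T\<^sup>2) \<le> T / T\<^sup>2"
      proof -
        have "(\<Sum>k=1..2 ^ j. ?c k) \<le> real n"
          using sum_cell_count_le[of j n X] by (metis of_nat_le_iff of_nat_sum)
        then have "(\<Sum>k=1..2 ^ j. ?c k + 1) \<le> T"
          by (simp add: sum.distrib T_def)
        then show ?thesis
          unfolding sum_divide_distrib[symmetric] by (intro divide_right_mono) auto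
      qed
      ultimately show "(\<Sum>k=1..2 ^ j. ((?c k + 1) / T - \<pi> j k)\<^sup>2 + (?c k + 1) / T\<^sup>2) \<le>
          (\<Sum>k=1..2 ^ j. 2 * (V k X + (1 + B\<^sup>2)) / T\<^sup>2) + T / T\<^sup>2"
        unfolding sum.distrib by (intro add_mono sum_mono) auto
    qed (use \<delta> in simp)
    also have "\<dots> = W X"
      unfolding W_def sum_divide_distrib[symmetric] add_divide_distrib[symmetric] by simp
    finally show ?thesis .
  qed
  have "measure ?M {X \<in> space ?M. \<epsilon> < \<bar>posterior (histogram_prior j) n X A\<bar>} \<le>
      measure ?M {X \<in> space ?M. \<epsilon> \<le> W X}"
  proof (rule M.finite_measure_mono)
    have "W \<in> borel_measurable ?M"
      using W by (simp add: has_bochner_integral_iff borel_measurable_integrable)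
    then show "{X \<in> space ?M. \<epsilon> \<le> W X} \<in> sets ?M" by measurable
    show "{X \<in> space ?M. \<epsilon> < \<bar>posterior (histogram_prior j) n X A\<bar>} \<subseteq> {X \<in> space ?M. \<epsilon> \<le> W X}"
      using post_le by (auto intro: order.trans[OF less_imp_le])
  qed
  also have "\<dots> \<le> (\<integral>X. W X \<partial>?M) / \<epsilon>"
    using W W_nonneg \<epsilon> by (intro integral_Markov_inequality_measure[where A = "{}"]) (auto simp: has_bochner_integral_iff)
  also have "(\<integral>X. W X \<partial>?M) = ((\<Sum>k=1..2 ^ j. 2 * (real n * (\<pi> j k - (\<pi> j k)\<^sup>2) + (1 + B\<^sup>2))) + T) / (T\<^sup>2 * \<delta>)"
    using W by (simp only: has_bochner_integral_iff)
  also have "\<dots> / \<epsilon> \<le> ((3 + 2 * B + 2 * B\<^sup>2) * T) / (T\<^sup>2 * \<delta>) / \<epsilon>"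
  proof (intro divide_right_mono)
    \<comment> \<open>Each cell has mass at most \<open>B / 2 ^ j\<close>, so the variances add up
      to at most \<open>n * B\<close> whatever the number of cells.\<close>
    have "(\<Sum>k=1..2 ^ j. 2 * (real n * (\<pi> j k - (\<pi> j k)\<^sup>2) + (1 + B\<^sup>2))) \<le>
        (\<Sum>k\<in>{1..2 ^ j :: nat}. 2 * (real n * (B / 2 ^ j) + (1 + B\<^sup>2)))"
    proof (intro sum_mono mult_left_mono add_right_mono)
      fix k assume k: "k \<in> {1..2 ^ j :: nat}"
      show "\<pi> j k - (\<pi> j k)\<^sup>2 \<le> B / 2 ^ j"
        using \<pi>(2)[OF k] zero_le_power2[of "\<pi> j k"] by linarith
    qed auto
    also have "\<dots> = 2 * (real n * B) + 2 ^ j * (2 * (1 + B\<^sup>2))"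
      by (simp add: field_simps)
    also have "\<dots> \<le> 2 * (T * B) + T * (2 * (1 + B\<^sup>2))"
      using B0 T by (intro add_mono mult_left_mono mult_right_mono) (auto simp: T_def)
    finally show "(\<Sum>k=1..2 ^ j. 2 * (real n * (\<pi> j k - (\<pi> j k)\<^sup>2) + (1 + B\<^sup>2))) + T \<le> (3 + 2 * B + 2 * B\<^sup>2) * T"
      by (simp add: algebra_simps)
  qed (use T \<delta> \<epsilon> in auto)
  also have "\<dots> = (3 + 2 * B + 2 * B\<^sup>2) / (T * \<delta> * \<epsilon>)"
    using T by (simp add: power2_eq_square)
  also have "\<dots> \<le> (3 + 2 * B + 2 * B\<^sup>2) / (real n * \<delta> * \<epsilon>)"
    using T n \<delta> \<epsilon> B0 by (intro divide_left_mono mult_right_mono mult_pos_pos) auto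
  finally show ?thesis .
qed

section \<open>Rates\<close>

lemma ln_ge_1: "3 \<le> x \<Longrightarrow> 1 \<le> ln (x :: real)"
  using exp_le by (subst ln_ge_iff) auto

text \<open>Here \<open>x\<close> is the sample size, \<open>N\<close> the number of cells and
  \<open>e\<close> the exponent of the rate. The first bound rests on \<open>e\<close> \<le>
  \<open>\<gamma> * \<alpha>\<close> and serves the approximation error; the second makes the level
  logarithmic; the third shows that \<open>n\<close> times the squared radius for the weights
  diverges, by the identity \<open>1 - 2 * e = \<gamma> * (2 - 2 * \<beta>)\<close>.\<close>

lemma rate_bounds:
  fixes x N c1 c2 \<alpha> \<beta> K :: real
  defines "\<gamma> \<equiv> 1 / (2 * \<alpha> + 1)" and "e \<equiv> (\<alpha> - 1 / 2 + \<beta>) / (2 * \<alpha> + 1)"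
  assumes x: "3 \<le> x" and \<alpha>: "0 < \<alpha>" "\<alpha> \<le> 1" and \<beta>: "0 \<le> \<beta>" "\<beta> \<le> 1 / 2" and c: "0 < c1" "0 < c2" and N: "1 \<le> N"
    and lower: "c1 * (x / ln x) powr \<gamma> \<le> N" and upper: "N \<le> c2 * (x / ln x) powr \<gamma>"
  shows "(1 / N) powr \<alpha> \<le> c1 powr - \<alpha> * x powr - e * ln x"
    and "N \<le> c2 * x"
    and "K\<^sup>2 * c2 powr - (2 - 2 * \<beta>) * ln x ^ 4 \<le> x * (N powr \<beta> * (K * x powr - e * (ln x)\<^sup>2) / N)\<^sup>2"
proof -
  have l: "1 \<le> ln x" using ln_ge_1[OF x] .
  have \<gamma>: "0 < \<gamma>" "\<gamma> \<le> 1" "\<gamma> * \<alpha> \<le> 1" using \<alpha> by (simp_all add: \<gamma>_def)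
  have e: "e \<le> \<gamma> * \<alpha>" using \<alpha> \<beta> by (simp add: e_def \<gamma>_def divide_right_mono)
  have "(x / ln x) powr \<gamma> \<le> x powr \<gamma>"
    using l x \<gamma> by (intro powr_mono2) (auto simp: divide_le_eq)
  then have N_le: "N \<le> c2 * x powr \<gamma>"
    using upper c by (meson less_imp_le mult_left_mono order_trans)
  also have "c2 * x powr \<gamma> \<le> c2 * x powr 1"
    using \<gamma> x c by (intro mult_left_mono powr_mono) auto
  finally show "N \<le> c2 * x" using x by simp
  show "(1 / N) powr \<alpha> \<le> c1 powr - \<alpha> * x powr - e * ln x"
  proof -
    have pos: "0 < c1 * (x / ln x) powr \<gamma>" using c x l by simp
    have "(1 / N) powr \<alpha> \<le> (1 / (c1 * (x / ln x) powr \<gamma>)) powr \<alpha>"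
      using lower pos N \<alpha> by (intro powr_mono2 divide_left_mono) auto
    also have "\<dots> = c1 powr - \<alpha> * x powr - (\<gamma> * \<alpha>) * ln x powr (\<gamma> * \<alpha>)"
      using c x l by (simp add: powr_divide powr_mult powr_powr powr_minus field_simps)
    also have "\<dots> \<le> c1 powr - \<alpha> * x powr - e * ln x powr 1"
      using l x \<gamma> e by (intro mult_mono[OF mult_left_mono[OF powr_mono] powr_mono]) auto
    finally show ?thesis using l by simp
  qed
  show "K\<^sup>2 * c2 powr - (2 - 2 * \<beta>) * ln x ^ 4 \<le> x * (N powr \<beta> * (K * x powr - e * (ln x)\<^sup>2) / N)\<^sup>2"
  proof -
    have "(c2 * x powr \<gamma>) powr - (2 - 2 * \<beta>) \<le> N powr - (2 - 2 * \<beta>)"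
      using N_le N \<beta> by (intro powr_mono2') auto
    moreover have "(c2 * x powr \<gamma>) powr - (2 - 2 * \<beta>) = c2 powr - (2 - 2 * \<beta>) * x powr - (\<gamma> * (2 - 2 * \<beta>))"
      using c x by (simp add: powr_mult powr_powr algebra_simps)
    ultimately have "K\<^sup>2 * ln x ^ 4 * x powr (1 - 2 * e) * (c2 powr - (2 - 2 * \<beta>) * x powr - (\<gamma> * (2 - 2 * \<beta>))) \<le>
        K\<^sup>2 * ln x ^ 4 * x powr (1 - 2 * e) * N powr - (2 - 2 * \<beta>)"
      using l by (intro mult_left_mono) auto
    also have "K\<^sup>2 * ln x ^ 4 * x powr (1 - 2 * e) * (c2 powr - (2 - 2 * \<beta>) * x powr - (\<gamma> * (2 - 2 * \<beta>))) =
        K\<^sup>2 * c2 powr - (2 - 2 * \<beta>) * ln x ^ 4 * (x powr (1 - 2 * e) * x powr - (\<gamma> * (2 - 2 * \<beta>)))"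
      by (simp only: mult_ac)
    also have "x powr (1 - 2 * e) * x powr - (\<gamma> * (2 - 2 * \<beta>)) = 1"
    proof -
      have "1 - 2 * e + - (\<gamma> * (2 - 2 * \<beta>)) = 0"
        using \<alpha> by (simp add: e_def \<gamma>_def divide_simps) (simp add: algebra_simps)
      then show ?thesis using x by (simp add: powr_add[symmetric])
    qed
    also have "K\<^sup>2 * ln x ^ 4 * x powr (1 - 2 * e) * N powr - (2 - 2 * \<beta>) =
        x * (N powr \<beta> * (K * x powr - e * (ln x)\<^sup>2) / N)\<^sup>2"
    proof -
      have "x powr (1 - 2 * e) = x * (x powr - e)\<^sup>2"
        using x by (simp add: powr_diff powr_minus power2_eq_square field_simps powr_add[symmetric])
      moreover have "N powr - (2 - 2 * \<beta>) = (N powr \<beta> / N)\<^sup>2"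
      proof -
        have "(N powr \<beta> / N)\<^sup>2 = (N powr (\<beta> - 1)) powr 2"
          using N by (simp add: powr_diff)
        then show ?thesis using N by (simp add: powr_powr algebra_simps)
      qed
      ultimately show ?thesis
        by (simp add: power_mult_distrib power_divide mult_ac flip: power_mult)
    qed
    finally show ?thesis by simp
  qed
qed

text \<open>Turns the level factor of the modulus of continuity into \<open>ln x\<close>; the
  additive constants are absorbed by \<open>ln x\<close> \<ge> 1.\<close>

lemma level_le:
  fixes j :: nat and c x :: real
  assumes "2 ^ j \<le> c * x" "0 < c" "3 \<le> x"
  shows "real j + 1 \<le> (1 + (\<bar>ln c\<bar> + 1) / ln 2) * ln x"
proof -
  have l: "1 \<le> ln x" using ln_ge_1 assms by simp
  have "real j * ln 2 = ln (2 ^ j)" by (simp add: ln_realpow)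
  also have "\<dots> \<le> ln (c * x)" using assms by (subst ln_le_cancel_iff) auto
  also have "\<dots> = ln c + ln x" using assms by (simp add: ln_mult)
  also have "\<dots> \<le> \<bar>ln c\<bar> * ln x + ln x"
    using l by (smt (verit) mult_le_cancel_left1 abs_ge_self abs_ge_zero)
  finally have "real j \<le> (\<bar>ln c\<bar> * ln x + ln x) / ln 2"
    by (simp add: pos_le_divide_eq)
  with l have "real j + 1 \<le> (\<bar>ln c\<bar> * ln x + ln x) / ln 2 + ln x"
    by linarith
  then show ?thesis by (simp add: field_simps)
qed

lemma inverse_max_two_bounds:
  fixes r :: ereal
  shows "0 \<le> real_of_ereal (1 / max 2 r)" and "real_of_ereal (1 / max 2 r) \<le> 1 / 2"
proof -
  have "0 \<le> real_of_ereal (1 / max 2 r) \<and> real_of_ereal (1 / max 2 r) \<le> 1 / 2"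
  proof (cases "max 2 r")
    case (real s)
    then have "2 \<le> s"
      by (metis ereal_less_eq(3) max.cobounded1 numeral_eq_ereal)
    then show ?thesis unfolding real by (simp add: one_ereal_def)
  next
    case MInf
    then show ?thesis by (simp add: max_def split: if_splits)
  qed simp
  then show "0 \<le> real_of_ereal (1 / max 2 r)" "real_of_ereal (1 / max 2 r) \<le> 1 / 2" by auto
qed

text \<open>The order of quantifiers encodes the dependence: \<open>\<eta>\<close> is chosen from
  \<open>\<alpha>\<close> and \<open>r\<close> alone, while \<open>M\<close> may also depend on
  \<open>p0\<close> and on the sequence \<open>j\<close>.\<close>

theorem proposition3:
  fixes \<alpha> :: real and r :: ereal
  assumes "0 < \<alpha>" and "\<alpha> \<le> 1" and "1 \<le> r" and "\<alpha> > 1/2 \<or> r = 1"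
  shows "\<exists>\<eta>>0. \<forall>(p0 :: real \<Rightarrow> real) (j :: nat \<Rightarrow> nat).
    p0 \<in> densities \<and> p0 \<in> holder_class \<alpha> \<and> (\<forall>x\<in>{0..1}. 0 < p0 x) \<and>
    (\<lambda>n. 2 ^ j n :: real) \<in> \<Theta>(\<lambda>n. (real n / ln (real n)) powr (1 / (2 * \<alpha> + 1))) \<longrightarrow>
    (\<exists>M>0. tendsto_in_prob (iid_law p0)
       (\<lambda>n X. posterior (histogram_prior (j n)) n X
          {p \<in> densities.
             ereal (M * real n powr (- ((\<alpha> - 1/2 + real_of_ereal (1 / max 2 r)) / (2 * \<alpha> + 1)))
                      * ln (real n) powr \<eta>)
             \<le> Lr_norm r (\<lambda>x. p x - p0 x)})
       0)"
proof (rule exI[of _ 2], intro conjI allI impI)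
  fix p0 :: "real \<Rightarrow> real" and j :: "nat \<Rightarrow> nat"
  assume asm: "p0 \<in> densities \<and> p0 \<in> holder_class \<alpha> \<and> (\<forall>x\<in>{0..1}. 0 < p0 x) \<and>
    (\<lambda>n. 2 ^ j n :: real) \<in> \<Theta>(\<lambda>n. (real n / ln (real n)) powr (1 / (2 * \<alpha> + 1)))"
  define \<beta> where "\<beta> = real_of_ereal (1 / max 2 r)"
  define e where "e = (\<alpha> - 1 / 2 + \<beta>) / (2 * \<alpha> + 1)"
  define \<pi> where "\<pi> i k = measure (density unit_interval (\<lambda>x. ennreal (p0 x))) (cell i k)" for i k
  have p0: "p0 \<in> densities" using asm by simp
  then have p0_meas: "p0 \<in> borel_measurable unit_interval" and p0_nonneg: "\<And>x. x \<in> {0..1} \<Longrightarrow> 0 \<le> p0 x"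
    by (auto simp: densities_def)
  from asm have "p0 \<in> holder_class \<alpha>" by simp
  then obtain C where C: "0 < C" and modulus: "\<And>i x y. x \<in> {0..1} \<Longrightarrow> y \<in> {0..1} \<Longrightarrow> \<bar>x - y\<bar> \<le> 1 / 2 ^ i \<Longrightarrow>
      \<bar>p0 x - p0 y\<bar> \<le> C * (real i + 1) * (1 / 2 ^ i) powr \<alpha>"
    using holder_class_modulus assms(1) by metis
  \<comment> \<open>The modulus at level 0, compared with the point 0, bounds \<open>p0\<close> on
    the whole interval.\<close>
  define B where "B = p0 0 + C"
  have B: "p0 x \<le> B" if "x \<in> {0..1}" for x
    using modulus[of x 0 0] that by (simp add: B_def)
  obtain c2 where c2: "0 < c2" and upper:
    "\<forall>\<^sub>F n in sequentially. 2 ^ j n \<le> c2 * (real n / ln (real n)) powr (1 / (2 * \<alpha> + 1))"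
    using asm by (auto dest!: bigthetaD1 elim!: landau_o.bigE)
  obtain c1 where c1: "0 < c1" and lower:
    "\<forall>\<^sub>F n in sequentially. c1 * (real n / ln (real n)) powr (1 / (2 * \<alpha> + 1)) \<le> 2 ^ j n"
    using asm by (auto dest!: bigthetaD2 elim!: landau_omega.bigE)
  define c3 where "c3 = 1 + (\<bar>ln c2\<bar> + 1) / ln 2"
  have c3: "0 < c3" unfolding c3_def by (intro add_pos_nonneg divide_nonneg_pos) auto
  define K where "K = C * c3 * c1 powr - \<alpha>"
  have K: "0 < K" using C c3 c1 by (simp add: K_def)
  \<comment> \<open>Of the two logarithms one bounds \<open>j n + 1\<close> and the other comes from
    the first rate bound; this is why \<open>\<eta> = 2\<close>. The constant \<open>K\<close> is
    chosen to make \<open>u\<close> dominate the approximation error.\<close>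
  define u where "u n = K * real n powr - e * (ln (real n))\<^sup>2" for n
  define S where "S n = {p \<in> densities. ereal (7 * K * real n powr - e * ln (real n) powr 2) \<le> Lr_norm r (\<lambda>x. p x - p0 x)}" for n
  define \<kappa> where "\<kappa> = K\<^sup>2 * c2 powr - (2 - 2 * \<beta>)"
  have \<kappa>: "0 < \<kappa>" using K c2 by (simp add: \<kappa>_def)
  define D where "D = 3 + 2 * B + 2 * B\<^sup>2"
  have D: "0 \<le> D" using B[of 0] p0_nonneg[of 0] by (simp add: D_def)
  have bound: "\<forall>\<^sub>F n in sequentially. \<forall>\<epsilon>>0.
      measure (iid_law p0) {X \<in> space (iid_law p0). \<epsilon> < \<bar>posterior (histogram_prior (j n)) n X (S n)\<bar>} \<le>
      D / (\<kappa> * \<epsilon>) / ln (real n) ^ 4"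
    using upper lower eventually_ge_at_top[of 3]
  proof eventually_elim
    case (elim n)
    define N where "N = (2 ^ j n :: real)"
    have n: "3 \<le> real n" using elim by simp
    have l: "1 \<le> ln (real n)" by (rule ln_ge_1[OF n])
    have N: "1 \<le> N" by (simp add: N_def)
    have \<beta>: "0 \<le> \<beta>" "\<beta> \<le> 1 / 2" unfolding \<beta>_def by (rule inverse_max_two_bounds)+
    note rates = rate_bounds[OF n assms(1,2) \<beta> c1 c2 N elim(2,1)[folded N_def], folded e_def]
    have u: "0 < u n" using K n l by (simp add: u_def)
    have bias: "C * (real (j n) + 1) * (1 / 2 ^ j n) powr \<alpha> \<le> u n"
    proof -
      have "C * (real (j n) + 1) * (1 / N) powr \<alpha> \<le>
          C * (c3 * ln (real n)) * (c1 powr - \<alpha> * real n powr - e * ln (real n))"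
        using level_le[OF rates(2)[unfolded N_def] c2 n] rates(1) C c3 l
        by (intro mult_mono mult_left_mono) (auto simp: c3_def)
      also have "\<dots> = u n" by (simp add: u_def K_def power2_eq_square mult_ac)
      finally show ?thesis by (simp add: N_def)
    qed
    \<comment> \<open>\<open>N * \<pi>\<close> is the average of \<open>p0\<close> over the cell, so
      it differs from any value there by at most the oscillation.\<close>
    have close: "\<bar>N * \<pi> (j n) k - p0 x\<bar> \<le> u n" if k: "k \<in> {1..2 ^ j n}" and x: "x \<in> cell (j n) k" for k x
    proof -
      have osc: "\<bar>p0 y - p0 x\<bar> \<le> u n" if y: "y \<in> cell (j n) k" for y
      proof -
        have "\<bar>y - x\<bar> \<le> 1 / 2 ^ j n"
          using x y cell_length[of k "j n"] by auto
        then show ?thesis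
          using modulus[of y x "j n"] x y cell_subset[OF k] bias by (meson order_trans subsetD)
      qed
      have "0 \<le> p0 x + u n" using p0_nonneg[of x] x cell_subset[OF k] u by auto
      from measure_cell_bounds[OF p0 k _ _ this, of "p0 x - u n"] osc
      have "(p0 x - u n) / N \<le> \<pi> (j n) k" "\<pi> (j n) k \<le> (p0 x + u n) / N"
        unfolding \<pi>_def N_def by (force simp: abs_le_iff)+
      then show ?thesis using N by (simp add: abs_le_iff field_simps)
    qed
    \<comment> \<open>After multiplication by \<open>N\<^sup>2\<close> this is exactly the square
      sum allowed by \<open>Lr_norm_histogram_diff_le\<close>.\<close>
    define \<delta> where "\<delta> = (N powr \<beta> * u n / N)\<^sup>2"
    have \<delta>: "0 < \<delta>" using N u by (simp add: \<delta>_def)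
    \<comment> \<open>By contraposition: weights with square sum below \<open>\<delta>\<close> give
      a norm at most \<open>6 * u n\<close>, whereas membership in \<open>S n\<close> forces at
      least \<open>7 * u n\<close>. The gap between 6 and 7 explains the choice
      \<open>M = 7 * K\<close>.\<close>
    have far: "\<delta> \<le> (\<Sum>k=1..2 ^ j n. (a k - \<pi> (j n) k)\<^sup>2)" if "histogram (j n) a \<in> S n" for a
    proof (rule ccontr)
      assume "\<not> \<delta> \<le> (\<Sum>k=1..2 ^ j n. (a k - \<pi> (j n) k)\<^sup>2)"
      then have "N\<^sup>2 * (\<Sum>k=1..2 ^ j n. (a k - \<pi> (j n) k)\<^sup>2) \<le> N\<^sup>2 * \<delta>"
        by (intro mult_left_mono) auto
      also have "N\<^sup>2 * \<delta> = (N powr \<beta> * u n)\<^sup>2"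
        using N by (simp add: \<delta>_def power_divide)
      also have "N\<^sup>2 * (\<Sum>k=1..2 ^ j n. (a k - \<pi> (j n) k)\<^sup>2) = (\<Sum>k=1..2 ^ j n. (N * a k - N * \<pi> (j n) k)\<^sup>2)"
        unfolding sum_distrib_left by (simp add: power_mult_distrib right_diff_distrib[symmetric])
      finally have "Lr_norm r (\<lambda>x. histogram (j n) a x - p0 x) \<le> ereal (6 * u n)"
        using close unfolding N_def \<beta>_def
        by (intro Lr_norm_histogram_diff_le[OF assms(3) p0_meas u, where q = "\<lambda>k. 2 ^ j n * \<pi> (j n) k"])
      moreover have "ereal (7 * K * real n powr - e * ln (real n) powr 2) \<le> Lr_norm r (\<lambda>x. histogram (j n) a x - p0 x)"
        using that by (simp add: S_def)
      ultimately have "ereal (7 * K * real n powr - e * ln (real n) powr 2) \<le> ereal (6 * u n)"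
        by (rule order_trans[rotated])
      then have "7 * u n \<le> 6 * u n"
        using l by (simp add: u_def mult_ac)
      with u show False by simp
    qed
    show ?case
    proof (intro allI impI)
      fix \<epsilon> :: real assume \<epsilon>: "0 < \<epsilon>"
      have "measure (iid_law p0) {X \<in> space (iid_law p0). \<epsilon> < \<bar>posterior (histogram_prior (j n)) n X (S n)\<bar>} \<le>
          D / (real n * \<delta> * \<epsilon>)"
        unfolding D_def using n far unfolding \<pi>_def
        by (intro posterior_tail_bound p0 B \<delta> \<epsilon>) auto
      \<comment> \<open>The third rate bound says that \<open>n * \<delta>\<close> is at least
        \<open>\<kappa> * ln n ^ 4\<close>; the fourth power stems from squaring the two logarithms
        in \<open>u\<close>, and it drives the probability to zero.\<close>
      also have "\<dots> \<le> D / (\<kappa> * ln (real n) ^ 4 * \<epsilon>)"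
        using rates(3)[of K] \<epsilon> \<kappa> l n \<delta> D
        by (intro divide_left_mono mult_right_mono mult_pos_pos) (auto simp: \<delta>_def \<kappa>_def u_def)
      finally show "measure (iid_law p0) {X \<in> space (iid_law p0). \<epsilon> < \<bar>posterior (histogram_prior (j n)) n X (S n)\<bar>} \<le>
          D / (\<kappa> * \<epsilon>) / ln (real n) ^ 4"
        by (simp add: mult_ac)
    qed
  qed
  have "tendsto_in_prob (iid_law p0) (\<lambda>n X. posterior (histogram_prior (j n)) n X (S n)) 0"
    unfolding tendsto_in_prob_def
  proof (intro conjI allI impI)
    show "(\<lambda>X. posterior (histogram_prior (j n)) n X (S n)) \<in> borel_measurable (iid_law p0)" for n
      unfolding iid_law_def by (rule borel_measurable_posterior)
    fix \<epsilon> :: real assume \<epsilon>: "0 < \<epsilon>"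
    have "filterlim (\<lambda>n. ln (real n)) at_top sequentially"
      by (rule filterlim_compose[OF ln_at_top filterlim_real_sequentially])
    then have "filterlim (\<lambda>n. ln (real n) ^ 4) at_top sequentially"
      by (intro filterlim_pow_at_top) auto
    then have lim: "(\<lambda>n. D / (\<kappa> * \<epsilon>) / ln (real n) ^ 4) \<longlonglongrightarrow> 0"
      by (rule tendsto_divide_0[OF tendsto_const filterlim_at_top_imp_at_infinity])
    show "(\<lambda>n. measure (iid_law p0) {X \<in> space (iid_law p0).
        \<epsilon> < \<bar>posterior (histogram_prior (j n)) n X (S n) - 0\<bar>}) \<longlonglongrightarrow> 0"
      using bound \<epsilon>
      by (intro tendsto_sandwich[OF _ _ tendsto_const lim]) (auto elim!: eventually_mono)
  qed
  then show "\<exists>M>0. tendsto_in_prob (iid_law p0)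
       (\<lambda>n X. posterior (histogram_prior (j n)) n X
          {p \<in> densities.
             ereal (M * real n powr (- ((\<alpha> - 1/2 + real_of_ereal (1 / max 2 r)) / (2 * \<alpha> + 1)))
                      * ln (real n) powr 2)
             \<le> Lr_norm r (\<lambda>x. p x - p0 x)})
       0"
    using K unfolding S_def e_def \<beta>_def by (intro exI[of _ "7 * K"]) auto
qed simp

end
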